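(* Let $n=k=2$ and let $g=(g_i)_{|i|\le4}$, $g^{(0)}=(g^{(0)}_i)_{|i|\le4}\in\mathbb{R}^{15}$ be such that $sg+(1-s)g^{(0)}\in G_0$ for all $s\in[0,1]$. With the rational functions $r_{ji}$ constructed in the context, set, for $x=(x_i)_{|i|\le4}\in\mathbb{R}^{15}$, $$\Gamma_i(x,s)=sg_i+(1-s)g^{(0)}_i\quad(|i|\le4),\qquad \Gamma_j(x,s)=\sum_{|i|\le4}r_{ji}(x)\,\big(sg_i+(1-s)g^{(0)}_i\big)\quad(|j|\ge5).$$ Then the system of ordinary differential equations $$\sum_{|j|\le4}\Gamma_{i+j}(x(s),s)\,\frac{dx_j}{ds}(s)=g_i-g^{(0)}_i\quad(|i|\le4),\qquad x(0)=\lambda^*_{g^{(0)}},$$ has a $C^\infty$ solution $x=x(s)$ defined on a neighborhood of $[0,1]$, the matrix $[\Gamma_{i+j}(x(s),s)]_{|i|,|j|\le4}$ is defined and invertible for all $s\in[0,1]$, and $x(1)=\lambda^*_g$.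
   Context: Notation: $\mathbb{Z}_+=\{0,1,2,\dots\}$; all multiindices are in $\mathbb{Z}_+^2$; for $i=(i_1,i_2)$, $t^i=t_1^{i_1}t_2^{i_2}$ and $|i|=i_1+i_2$; inequalities between multiindices are componentwise; $e_1=(1,0)$, $e_2=(0,1)$; $x_{ab}$ means $x_{(a,b)}$; there are 15 multiindices $i\in\mathbb{Z}_+^2$ with $|i|\le4$. The sets $G$, $G_0$. A vector $g=(g_i)_{|i|\le4}\in\mathbb{R}^{15}$ has a representing density on $\mathbb{R}^2$ if there is a Lebesgue measurable $f\ge0$ a.e. on $\mathbb{R}^2$ with $\int|t^i|f\,dt<\infty$ and $\int t^if\,dt=g_i$ for all $|i|\le4$, where $f$ is not a.e. zero (the total mass $g_{(0,0)}>0$ is not required to be $1$). For such $g$, $\lambda^*=\lambda^*_g=(\lambda^*_i)_{|i|\le4}$ denotes the (existing, unique) vector maximizing $L_0(\lambda)=\sum_{|i|\le4}g_i\lambda_i-\int_{\mathbb{R}^2}e^{\sum_{|i|\le4}\lambda_it^i}dt\in[-\infty,\infty)$ over $\lambda\in\mathbb{R}^{15}$. $G$ is the set of all such $g$ for which $\sum_{|i|=4}\lambda_i^*t^i<0$ for all $t\in\mathbb{R}^2\setminus\{0\}$. For $x=(x_i)_{|i|\le4}\in\mathbb{R}^{15}$ let $$A(x)=\begin{bmatrix} 4x_{40} & 0 & 0 & x_{31} & 0 & 0 \\ 3x_{31} & 4x_{40} & 0 & 2x_{22} & x_{31} & 0 \\ 2x_{22} & 3x_{31} & 4x_{40} & 3x_{13}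 & 2x_{22} & x_{31} \\ x_{13} & 2x_{22} & 3x_{31} & 4x_{04} & 3x_{13} & 2x_{22} \\ 0 & x_{13} & 2x_{22} & 0 & 4x_{04} & 3x_{13} \\ 0 & 0 & x_{13} & 0 & 0 & 4x_{04} \end{bmatrix},$$ and let $G_0=\{g\in G:\det A(\lambda^*_g)\ne0\}$. (For $g\in G$ one has $\lambda^*_{(4,0)}<0$.) Construction of $r_{ji}(x)$ ($|i|\le4$, $|j|\ge5$), for $x$ with $x_{40}\ne0$ and $\det A(x)\neq0$. Put $x_\kappa=0$ if $\kappa\not\ge0$. Fix $j_0\in\mathbb{Z}_+^2$ with $|j_0|\ge5$ and let $l=|j_0|-1\ge4$. For $0\le q\le l+1$ let $\delta_q=1$ if $j_0=(l+1-q,q)$ and $\delta_q=0$ otherwise. Define numbers $\alpha_q,\beta_q$ ($0\le q\le l-2$), with $\alpha_q=\beta_q=0$ for $q<0$ and for $q\ge l-1$, as follows. If $l\ge5$, put $\alpha_0=\dots=\alpha_{l-5}=0$ and define $\beta_0,\dots,\beta_{l-5}$ inductively by $$4x_{40}\beta_q=-\sum_{p=0}^{q-1}(4+p-q)\,x_{(4+p-q,\,q-p)}\,\beta_p+\delta_q\qquad(0\le q\le l-5).$$ Put $y=-3x_{31}\beta_{l-5}-2x_{22}\beta_{l-6}-x_{13}\beta_{l-7}$, $z=-2x_{22}\beta_{l-5}-x_{13}\beta_{l-6}$, $w=-x_{13}\beta_{l-5}$ (so $y=z=w=0$ if $l=4$), and determine the remaining $\alpha_q,\beta_q$ from $$A(x)\,(\beta_{l-4},\beta_{l-3},\beta_{l-2},-\alpha_{l-4},-\alpha_{l-3},-\alpha_{l-2})^{T}=(y+\delta_{l-4},\,z+\delta_{l-3},\,w+\delta_{l-2},\,\delta_{l-1},\,\delta_l,\,\delta_{l+1})^{T}.$$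 Put $a_{(l-2-q,q)}=\alpha_q$, $b_{(l-2-q,q)}=\beta_q$ for $0\le q\le l-2$. For $i\in\mathbb{Z}_+^2$ with $|i|\le l$ let $I_i=\{\kappa\in\mathbb{Z}_+^2:\kappa\le i,\ |\kappa|=|i|+2-l\}$ and $$c_{j_0i}(x)=\sum_{\kappa\in I_i}\big[(\kappa_2+1)x_{\kappa+e_2}a_{i-\kappa}-(\kappa_1+1)x_{\kappa+e_1}b_{i-\kappa}\big]+d_{j_0i},$$ where $d_{j_0i}=(i_2+1)a_{i+e_2}-(i_1+1)b_{i+e_1}$ if $|i|=l-3$ and $d_{j_0i}=0$ otherwise. Finally, for $|i|\le4$ put $r_{\iota i}(x)=1$ if $\iota=i$ and $0$ otherwise when $|\iota|\le4$, and define recursively on $|j|$ $$r_{ji}(x)=\sum_{|\iota|<|j|}c_{j\iota}(x)\,r_{\iota i}(x)\qquad(|j|\ge5).$$ *)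

theory Defs
  imports "HOL-Analysis.Analysis"
begin

text \<open>
  Multiindices are pairs of naturals; addition, subtraction and the order on pairs are the
  componentwise ones of the library. The type \<open>idx4\<close> of the 15 multiindices of degree at most 4
  indexes the coordinates, so that the vectors in question are of type \<open>real ^ idx4\<close>.
\<close>

definition mdeg :: "nat \<times> nat \<Rightarrow> nat" where
  "mdeg i = fst i + snd i"

typedef idx4 = "{i :: nat \<times> nat. mdeg i \<le> 4}" morphisms mi Idx
  by (rule exI[of _ "(0, 0)"]) (simp add: mdeg_def)

lemma finite_mdeg_le: "finite {i :: nat \<times> nat. mdeg i \<le> n}"
  by (rule finite_subset[of _ "{..n} \<times> {..n}"]) (auto simp: mdeg_def)

instance idx4 :: finite
proof
  have "(UNIV :: idx4 set) = Idx ` {i. mdeg i \<le> 4}"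
    using type_definition.Abs_image[OF type_definition_idx4] by simp
  then show "finite (UNIV :: idx4 set)"
    by (metis finite_mdeg_le finite_imageI)
qed

definition monom2 :: "nat \<times> nat \<Rightarrow> real \<times> real \<Rightarrow> real" where
  "monom2 i t = fst t ^ fst i * snd t ^ snd i"

text \<open>Only meaningful for \<open>a + b \<le> 4\<close>.\<close>

abbreviation co :: "real ^ idx4 \<Rightarrow> nat \<Rightarrow> nat \<Rightarrow> real" where
  "co x a b \<equiv> x $ Idx (a, b)"

text \<open>The convention that coordinates with a negative component in the index are zero.\<close>

definition coZ :: "real ^ idx4 \<Rightarrow> int \<Rightarrow> int \<Rightarrow> real" where
  "coZ x a b = (if 0 \<le> a \<and> 0 \<le> b then co x (nat a) (nat b) else 0)"

definition has_representing_density :: "real ^ idx4 \<Rightarrow> bool" where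
  "has_representing_density g \<longleftrightarrow>
     (\<exists>f :: real \<times> real \<Rightarrow> real.
        f \<in> borel_measurable lebesgue \<and>
        (AE t in lebesgue. 0 \<le> f t) \<and>
        \<not> (AE t in lebesgue. f t = 0) \<and>
        (\<forall>i. integrable lebesgue (\<lambda>t. \<bar>monom2 (mi i) t\<bar> * f t) \<and>
             (LINT t|lebesgue. monom2 (mi i) t * f t) = g $ i))"

definition L0 :: "real ^ idx4 \<Rightarrow> real ^ idx4 \<Rightarrow> ereal" where
  "L0 g x = ereal (\<Sum>i\<in>UNIV. g $ i * x $ i) -
     enn2ereal (\<integral>\<^sup>+ t. ennreal (exp (\<Sum>i\<in>UNIV. x $ i * monom2 (mi i) t)) \<partial>lebesgue)"

definition lambda_star :: "real ^ idx4 \<Rightarrow> real ^ idx4" where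
  "lambda_star g = (THE x. \<forall>y. L0 g y \<le> L0 g x)"

definition G_set :: "(real ^ idx4) set" where
  "G_set = {g. has_representing_density g \<and>
     (\<forall>t. t \<noteq> 0 \<longrightarrow> (\<Sum>i | mdeg (mi i) = 4. lambda_star g $ i * monom2 (mi i) t) < 0)}"

text \<open>The function \<open>vector\<close> fills the entries \<open>1, \<dots>, 6\<close> in order, where \<open>6 = 0\<close> in the index type.\<close>

definition A_mat :: "real ^ idx4 \<Rightarrow> real ^ 6 ^ 6" where
  "A_mat x = vector [
     vector [4 * co x 4 0, 0, 0, co x 3 1, 0, 0],
     vector [3 * co x 3 1, 4 * co x 4 0, 0, 2 * co x 2 2, co x 3 1, 0],
     vector [2 * co x 2 2, 3 * co x 3 1, 4 * co x 4 0, 3 * co x 1 3, 2 * co x 2 2, co x 3 1],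
     vector [co x 1 3, 2 * co x 2 2, 3 * co x 3 1, 4 * co x 0 4, 3 * co x 1 3, 2 * co x 2 2],
     vector [0, co x 1 3, 2 * co x 2 2, 0, 4 * co x 0 4, 3 * co x 1 3],
     vector [0, 0, co x 1 3, 0, 0, 4 * co x 0 4]]"

definition G0_set :: "(real ^ idx4) set" where
  "G0_set = {g \<in> G_set. det (A_mat (lambda_star g)) \<noteq> 0}"

text \<open>
  Below, \<open>j\<close> is a multiindex of degree at least 5 and \<open>l = |j| - 1\<close>. Since \<open>l - 5\<close>, \<open>l - 6\<close>, \<open>l - 7\<close>
  may be negative, \<open>l\<close> and the position \<open>q\<close> are integers outside the recursion for \<open>beta_rec\<close>.
\<close>

definition ell :: "nat \<times> nat \<Rightarrow> int" where
  "ell j = int (mdeg j) - 1"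

definition delta :: "nat \<times> nat \<Rightarrow> int \<Rightarrow> real" where
  "delta j q = (if (int (fst j), int (snd j)) = (ell j + 1 - q, q) then 1 else 0)"

fun beta_rec :: "real ^ idx4 \<Rightarrow> nat \<times> nat \<Rightarrow> nat \<Rightarrow> real" where
  "beta_rec x j q =
     (- (\<Sum>p<q. real_of_int (4 + int p - int q) *
              coZ x (4 + int p - int q) (int q - int p) * beta_rec x j p)
      + delta j (int q)) / (4 * co x 4 0)"

declare beta_rec.simps [simp del]

definition beta_low :: "real ^ idx4 \<Rightarrow> nat \<times> nat \<Rightarrow> int \<Rightarrow> real" where
  "beta_low x j q = (if 0 \<le> q \<and> q \<le> ell j - 5 then beta_rec x j (nat q) else 0)"

definition rhs_vec :: "real ^ idx4 \<Rightarrow> nat \<times> nat \<Rightarrow> real ^ 6" where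
  "rhs_vec x j =
    (let l = ell j;
         y = - 3 * co x 3 1 * beta_low x j (l - 5) - 2 * co x 2 2 * beta_low x j (l - 6)
             - co x 1 3 * beta_low x j (l - 7);
         z = - 2 * co x 2 2 * beta_low x j (l - 5) - co x 1 3 * beta_low x j (l - 6);
         w = - co x 1 3 * beta_low x j (l - 5)
     in vector [y + delta j (l - 4), z + delta j (l - 3), w + delta j (l - 2),
                delta j (l - 1), delta j l, delta j (l + 1)])"

text \<open>
  For \<open>det (A_mat x) \<noteq> 0\<close>, the unique solution \<open>v\<close> of \<open>A_mat x *v v = rhs_vec x j\<close>; its entries are
  the last three \<open>\<beta>\<^sub>q\<close> followed by the negatives of the last three \<open>\<alpha>\<^sub>q\<close>.
\<close>

definition sol_vec :: "real ^ idx4 \<Rightarrow> nat \<times> nat \<Rightarrow> real ^ 6" where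
  "sol_vec x j = matrix_inv (A_mat x) *v rhs_vec x j"

definition beta :: "real ^ idx4 \<Rightarrow> nat \<times> nat \<Rightarrow> int \<Rightarrow> real" where
  "beta x j q =
     (if q = ell j - 4 then sol_vec x j $ 1
      else if q = ell j - 3 then sol_vec x j $ 2
      else if q = ell j - 2 then sol_vec x j $ 3
      else beta_low x j q)"

definition alpha :: "real ^ idx4 \<Rightarrow> nat \<times> nat \<Rightarrow> int \<Rightarrow> real" where
  "alpha x j q =
     (if q = ell j - 4 then - sol_vec x j $ 4
      else if q = ell j - 3 then - sol_vec x j $ 5
      else if q = ell j - 2 then - sol_vec x j $ 6
      else 0)"

text \<open>The numbers \<open>a\<^sub>i\<close>, \<open>b\<^sub>i\<close> occur only for \<open>|i| = l - 2\<close>, where \<open>i = (l - 2 - q, q)\<close> with \<open>q = i\<^sub>2\<close>.\<close>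

definition a_co :: "real ^ idx4 \<Rightarrow> nat \<times> nat \<Rightarrow> nat \<times> nat \<Rightarrow> real" where
  "a_co x j i = alpha x j (int (snd i))"

definition b_co :: "real ^ idx4 \<Rightarrow> nat \<times> nat \<Rightarrow> nat \<times> nat \<Rightarrow> real" where
  "b_co x j i = beta x j (int (snd i))"

definition I_set :: "nat \<times> nat \<Rightarrow> nat \<times> nat \<Rightarrow> (nat \<times> nat) set" where
  "I_set j i = {k. k \<le> i \<and> int (mdeg k) = int (mdeg i) + 2 - ell j}"

definition d_co :: "real ^ idx4 \<Rightarrow> nat \<times> nat \<Rightarrow> nat \<times> nat \<Rightarrow> real" where
  "d_co x j i =
     (if int (mdeg i) = ell j - 3
      then real (snd i + 1) * a_co x j (i + (0, 1)) - real (fst i + 1) * b_co x j (i + (1, 0))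
      else 0)"

text \<open>Used only for \<open>|i| \<le> l\<close>, so that the coordinates of \<open>x\<close> that occur have degree at most 3.\<close>

definition c_co :: "real ^ idx4 \<Rightarrow> nat \<times> nat \<Rightarrow> nat \<times> nat \<Rightarrow> real" where
  "c_co x j i =
     (\<Sum>k\<in>I_set j i. real (snd k + 1) * x $ Idx (k + (0, 1)) * a_co x j (i - k)
                  - real (fst k + 1) * x $ Idx (k + (1, 0)) * b_co x j (i - k))
     + d_co x j i"

function r_co :: "real ^ idx4 \<Rightarrow> nat \<times> nat \<Rightarrow> nat \<times> nat \<Rightarrow> real" where
  "r_co x j i =
     (if mdeg j \<le> 4 then (if j = i then 1 else 0)
      else (\<Sum>k | mdeg k < mdeg j. c_co x j k * r_co x k i))"
  by pat_completeness auto
termination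
  by (relation "Wellfounded.measure (\<lambda>(x, j, i). mdeg j)") auto

declare r_co.simps [simp del]

text \<open>The condition under which all \<open>r\<^sub>j\<^sub>i(x)\<close> are defined.\<close>

definition r_defined :: "real ^ idx4 \<Rightarrow> bool" where
  "r_defined x \<longleftrightarrow> co x 4 0 \<noteq> 0 \<and> det (A_mat x) \<noteq> 0"

definition Gam :: "real ^ idx4 \<Rightarrow> real ^ idx4 \<Rightarrow> real ^ idx4 \<Rightarrow> real \<Rightarrow> nat \<times> nat \<Rightarrow> real" where
  "Gam g g0 x s j =
     (if mdeg j \<le> 4 then s * g $ Idx j + (1 - s) * g0 $ Idx j
      else (\<Sum>i\<in>UNIV. r_co x j (mi i) * (s * g $ i + (1 - s) * g0 $ i)))"

definition Gam_mat :: "real ^ idx4 \<Rightarrow> real ^ idx4 \<Rightarrow> real ^ idx4 \<Rightarrow> real \<Rightarrow> real ^ idx4 ^ idx4" where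
  "Gam_mat g g0 x s = (\<chi> i j. Gam g g0 x s (mi i + mi j))"

text \<open>\<open>C\<^sup>\<infinity>\<close> curves on an open set: \<open>D n\<close> is the \<open>n\<close>-th derivative.\<close>

definition smooth_curve_on :: "real set \<Rightarrow> (real \<Rightarrow> 'a :: real_normed_vector) \<Rightarrow> bool" where
  "smooth_curve_on S x \<longleftrightarrow>
     (\<exists>D. D 0 = x \<and> (\<forall>n. \<forall>s\<in>S. (D n has_vector_derivative D (Suc n) s) (at s)))"

end

theory Submission
  imports Defs "HOL-Probability.Sinc_Integral"
begin

text \<open>
  Write \<open>p\<^sub>x(t) = \<Sum>\<^sub>i x\<^sub>i t\<^sup>i\<close> and \<open>M\<^sub>j(x) = \<integral> t\<^sup>j e\<^bsup>p\<^sub>x\<^esup> dt\<close>. On the open set of those \<open>x\<close> for which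
  \<open>p\<^sub>x\<close> tends to \<open>-\<infinity>\<close> at least as fast as some \<open>-c |t|\<^sup>4\<close>, \<open>c > 0\<close> (\<open>decaying\<close>), all \<open>M\<^sub>j\<close> are finite and smooth, with
  \<open>\<partial>M\<^sub>j / \<partial>x\<^sub>k = M\<^bsub>j+k\<^esub>\<close> (\<open>has_derivative_mom\<close>). The map \<open>F(x) = (M\<^sub>i(x))\<close>, \<open>|i| \<le> 4\<close>, is the gradient of
  the strictly convex function \<open>M\<^sub>0\<close>: it is injective (\<open>inj_on_momvec\<close>), and its derivative, the
  Gram matrix \<open>H(x) = [M\<^bsub>i+j\<^esub>(x)]\<close>, is positive definite (\<open>invertible_hess\<close>).

  The function \<open>L\<^sub>0\<close> equals \<open>g \<bullet> x - M\<^sub>0(x)\<close>, so that a maximizer in the open set satisfies \<open>F(x) = g\<close>.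
  Since \<open>L\<^sub>0\<close> is upper semicontinuous, coercive and strictly concave where it is finite, the maximizer
  exists and is unique, and \<open>F(\<lambda>\<^sup>*\<^sub>g) = g\<close> for \<open>g \<in> G\<close> (\<open>momvec_lambda_star\<close>). Thus \<open>\<lambda>\<^sup>*\<^sub>g = F\<^sup>-\<^sup>1(g)\<close>,
  and the curve sought is \<open>x(s) = F\<^sup>-\<^sup>1(s g + (1-s) g\<^sup>0)\<close>. Differentiating \<open>F(x(s)) = s g + (1-s) g\<^sup>0\<close>
  gives \<open>H(x(s)) x'(s) = g - g\<^sup>0\<close>.

  It remains to see that \<open>\<Gamma>\<^bsub>i+j\<^esub>(x(s), s)\<close> is the entry \<open>M\<^bsub>i+j\<^esub>(x(s))\<close> of \<open>H(x(s))\<close>, that is, that the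
  \<open>r\<^sub>j\<^sub>i\<close> express the moments of higher order by those of order at most 4 (\<open>mom_eq_r_co\<close>). For this let
  \<open>a\<close>, \<open>b\<close> be the homogeneous polynomials of degree \<open>|j| - 3\<close> with the coefficients \<open>\<alpha>\<close>, \<open>\<beta>\<close>. The integral
  of \<open>\<partial>\<^sub>2(a e\<^sup>p) - \<partial>\<^sub>1(b e\<^sup>p) = (\<partial>\<^sub>2a - \<partial>\<^sub>1b + a \<partial>\<^sub>2p - b \<partial>\<^sub>1p) e\<^sup>p\<close> is zero. The linear equations for
  \<open>\<alpha>\<close>, \<open>\<beta>\<close> say that the leading form of the polynomial factor is \<open>-t\<^sup>j\<close>
  (\<open>leading_coefficient_eq\<close>), and its remaining coefficients are the \<open>c\<^sub>j\<^sub>i\<close>. Thus \<open>M\<^sub>j = \<Sum> c\<^sub>j\<^sub>i M\<^sub>i\<close> over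
  \<open>|i| < |j|\<close> (\<open>mom_reduction\<close>).

  The curve is \<open>C\<^sup>\<infinity>\<close> because, by Cramer's rule, the algebra of functions of \<open>s\<close> generated by its
  coordinates, the moments \<open>M\<^sub>j(x(s))\<close> and \<open>1 / det H(x(s))\<close> is closed under differentiation
  (\<open>curve_alg_differentiable\<close>).
\<close>

section \<open>Polynomials of degree four and decay of their exponentials\<close>

definition pol :: "real ^ idx4 \<Rightarrow> real \<times> real \<Rightarrow> real" where
  "pol x t = (\<Sum>i\<in>UNIV. x $ i * monom2 (mi i) t)"

text \<open>A weight of the size of \<open>\<bar>t\<bar>\<^sup>4\<close> at infinity and at least 1, so that it also dominates the
  monomials of degree less than 4.\<close>

definition wt :: "real \<times> real \<Rightarrow> real" where
  "wt t = 1 + fst t ^ 4 + snd t ^ 4"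

definition decaying :: "(real ^ idx4) set" where
  "decaying = {x. \<exists>c>0. \<exists>C. \<forall>t. pol x t \<le> C - c * wt t}"

definition mom :: "real ^ idx4 \<Rightarrow> nat \<times> nat \<Rightarrow> real" where
  "mom x j = (LINT t|lborel. monom2 j t * exp (pol x t))"

lemma wt_ge_1: "1 \<le> wt t"
  by (simp add: wt_def)

lemma monom2_add: "monom2 (i + j) t = monom2 i t * monom2 j t"
  by (simp add: monom2_def power_add)

lemma continuous_monom2 [continuous_intros]: "continuous_on S (monom2 j)"
  unfolding monom2_def by (intro continuous_intros)

lemma continuous_pol [continuous_intros]: "continuous_on S (pol x)"
  unfolding pol_def by (intro continuous_intros)

lemma measurable_monom2 [measurable]: "monom2 j \<in> borel_measurable borel"
  by (intro borel_measurable_continuous_onI continuous_intros)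

lemma measurable_pol [measurable]: "pol x \<in> borel_measurable borel"
  by (intro borel_measurable_continuous_onI continuous_intros)

lemma measurable_wt [measurable]: "wt \<in> borel_measurable borel"
  unfolding wt_def by (intro borel_measurable_continuous_onI continuous_intros)

lemma pol_add: "pol (x + y) t = pol x t + pol y t"
  by (simp add: pol_def algebra_simps sum.distrib)

lemma pol_diff: "pol (x - y) t = pol x t - pol y t"
  by (simp add: pol_def algebra_simps sum_subtractf)

lemma pol_scale: "pol (c *\<^sub>R x) t = c * pol x t"
  by (simp add: pol_def algebra_simps sum_distrib_left)

lemma abs_monom2_le_max:
  fixes t :: "real \<times> real"
  defines "m \<equiv> max 1 (max \<bar>fst t\<bar> \<bar>snd t\<bar>)"
  shows "\<bar>monom2 j t\<bar> \<le> m ^ mdeg j" and "m ^ 4 \<le> wt t" and "1 \<le> m"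
proof -
  show "1 \<le> m" by (simp add: m_def)
  have "\<bar>fst t\<bar> ^ fst j * \<bar>snd t\<bar> ^ snd j \<le> m ^ fst j * m ^ snd j"
    by (intro mult_mono power_mono) (auto simp: m_def)
  then show "\<bar>monom2 j t\<bar> \<le> m ^ mdeg j"
    by (simp add: monom2_def mdeg_def power_add abs_mult power_abs)
  show "m ^ 4 \<le> wt t"
    unfolding m_def wt_def max_def by auto
qed

lemma abs_monom2_le_wt:
  assumes "mdeg j \<le> 4"
  shows "\<bar>monom2 j t\<bar> \<le> wt t"
proof -
  note m = abs_monom2_le_max(1)[of j t] abs_monom2_le_max(2,3)[of t]
  from m(1) power_increasing[OF assms m(3)] m(2) show ?thesis by linarith
qed

lemma abs_monom2_le_wt_power: "\<bar>monom2 j t\<bar> \<le> wt t ^ mdeg j"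
proof -
  note m = abs_monom2_le_max(1)[of j t] abs_monom2_le_max(2,3)[of t]
  let ?m = "max 1 (max \<bar>fst t\<bar> \<bar>snd t\<bar>)"
  have "?m ^ 1 \<le> ?m ^ 4" using m(3) by (intro power_increasing) auto
  then have "?m \<le> wt t" using m(2) by (simp only: power_one_right)
  then have "?m ^ mdeg j \<le> wt t ^ mdeg j" using m(3) by (intro power_mono) (simp_all only: order_trans[OF zero_le_one])
  with m(1) show ?thesis by linarith
qed

lemma mdeg_mi: "mdeg (mi i) \<le> 4"
  using mi[of i] by simp

lemma abs_pol_le: "\<bar>pol x t\<bar> \<le> (\<Sum>i\<in>UNIV. \<bar>x $ i\<bar>) * wt t"
proof -
  have "\<bar>pol x t\<bar> \<le> (\<Sum>i\<in>UNIV. \<bar>x $ i\<bar> * wt t)"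
    unfolding pol_def
    by (rule order_trans[OF sum_abs])
       (intro sum_mono, simp add: abs_mult mult_left_mono abs_monom2_le_wt mdeg_mi)
  then show ?thesis by (simp add: sum_distrib_right)
qed

lemma abs_pol_le_norm: "\<bar>pol x t\<bar> \<le> real CARD(idx4) * norm x * wt t"
proof -
  have "(\<Sum>i\<in>UNIV. \<bar>x $ i\<bar>) \<le> (\<Sum>i\<in>(UNIV::idx4 set). norm x)"
    by (intro sum_mono component_le_norm_cart)
  then have "(\<Sum>i\<in>UNIV. \<bar>x $ i\<bar>) \<le> real CARD(idx4) * norm x" by simp
  with abs_pol_le[of x t] show ?thesis
    using wt_ge_1[of t] by (meson mult_right_mono order_trans zero_le_one)
qed

section \<open>Integrability\<close>

text \<open>The weight is at least \<open>(1 + t\<^sub>1\<^sup>2) (1 + t\<^sub>2\<^sup>2) / 2\<close>, whose reciprocal is a product of integrable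
  functions of one variable.\<close>

lemma integrable_inverse_wt: "integrable lborel (\<lambda>t. 1 / wt t)"
proof -
  let ?h = "\<lambda>u::real. inverse (1 + u\<^sup>2)"
  have h: "integrable lborel ?h"
    using integrable_inverse_1_plus_square by (simp add: set_integrable_def)
  have "integrable (lborel \<Otimes>\<^sub>M lborel) (\<lambda>t. ?h (fst t) * ?h (snd t))"
  proof (rule lborel_pair.Fubini_integrable)
    show "integrable lborel (\<lambda>u. LINT v|lborel. norm (?h (fst (u, v)) * ?h (snd (u, v))))"
      using h by (simp add: abs_mult)
    show "AE u in lborel. integrable lborel (\<lambda>v. ?h (fst (u, v)) * ?h (snd (u, v)))"
      using h by simp
  qed simp
  then have int: "integrable lborel (\<lambda>t. 2 * (?h (fst t) * ?h (snd t)))"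
    by (simp add: lborel_prod)
  have le: "norm (1 / wt t) \<le> norm (2 * (?h (fst t) * ?h (snd t)))" for t
  proof -
    obtain u v where t: "t = (u, v)" by force
    have "0 \<le> (u\<^sup>2 - v\<^sup>2)\<^sup>2 + (1 - u\<^sup>2)\<^sup>2 + (1 - v\<^sup>2)\<^sup>2 + u ^ 4 * 2 + v ^ 4 * 2" by simp
    then have "(1 + u\<^sup>2) * (1 + v\<^sup>2) \<le> 2 * (1 + u ^ 4 + v ^ 4)"
      by (simp add: power2_eq_square power4_eq_xxxx algebra_simps)
    moreover have "0 < 1 + u\<^sup>2" "0 < 1 + v\<^sup>2" "0 < 1 + u ^ 4 + v ^ 4"
      by (simp_all add: add_pos_nonneg)
    ultimately show ?thesis
      unfolding t wt_def by (simp add: divide_simps)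
  qed
  show ?thesis
    by (rule Bochner_Integration.integrable_bound[OF int]) (measurable, use le in auto)
qed

lemma integrable_le_wt:
  fixes \<phi> :: "real \<times> real \<Rightarrow> real"
  assumes [measurable]: "\<phi> \<in> borel_measurable borel" and "\<And>t. \<bar>\<phi> t\<bar> \<le> K / wt t"
  shows "integrable lborel \<phi>"
proof (rule Bochner_Integration.integrable_bound)
  show "integrable lborel (\<lambda>t. K * (1 / wt t))"
    by (intro integrable_mult_right integrable_inverse_wt)
  show "AE t in lborel. norm (\<phi> t) \<le> norm (K * (1 / wt t))"
    using assms(2) by (intro AE_I2) (metis abs_ge_self order_trans real_norm_def times_divide_eq_right mult.right_neutral)
qed simp

text \<open>Raise \<open>z \<le> e\<^sup>z\<close>, \<open>z = c w / (n + 1)\<close>, to the power \<open>n + 1\<close>.\<close>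

lemma power_mult_exp_le:
  fixes c :: real
  assumes "c > 0"
  obtains K where "K \<ge> 0" "\<And>w. w \<ge> 1 \<Longrightarrow> w ^ n * exp (- c * w) \<le> K / w"
proof
  let ?N = "real (Suc n)"
  let ?K = "(?N / c) ^ Suc n"
  show "?K \<ge> 0" using assms by simp
  fix w :: real assume w: "w \<ge> 1"
  have "c * w / ?N \<le> exp (c * w / ?N)"
    using exp_ge_add_one_self[of "c * w / ?N"] by linarith
  then have "(c * w / ?N) ^ Suc n \<le> exp (c * w / ?N) ^ Suc n"
    using assms w by (intro power_mono) auto
  also have "exp (c * w / ?N) ^ Suc n = exp (c * w)"
    by (subst exp_of_nat_mult[symmetric]) simp
  finally have "w ^ Suc n \<le> ?K * exp (c * w)"
    using assms by (simp add: power_divide power_mult_distrib pos_le_divide_eq pos_divide_le_eq mult_ac del: power_Suc)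
  then have "w ^ Suc n * exp (- c * w) \<le> ?K"
    by (simp add: exp_minus field_simps del: power_Suc)
  then show "w ^ n * exp (- c * w) \<le> ?K / w"
    using w by (simp only: pos_le_divide_eq power_Suc mult_ac)
qed

lemma integrable_wt_exp:
  fixes \<phi> :: "real \<times> real \<Rightarrow> real"
  assumes "\<phi> \<in> borel_measurable borel" and "c > 0"
    and bound: "\<And>t. \<bar>\<phi> t\<bar> \<le> B * (wt t ^ n * exp (- c * wt t))"
  shows "integrable lborel \<phi>" and "\<exists>K\<ge>0. \<forall>t. \<bar>\<phi> t\<bar> \<le> K / wt t"
proof -
  obtain K where K: "K \<ge> 0" "\<And>w. w \<ge> 1 \<Longrightarrow> w ^ n * exp (- c * w) \<le> K / w"
    using power_mult_exp_le[OF \<open>c > 0\<close>] by blast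
  have *: "\<bar>\<phi> t\<bar> \<le> \<bar>B\<bar> * K / wt t" for t
  proof -
    have "\<bar>\<phi> t\<bar> \<le> \<bar>B\<bar> * (wt t ^ n * exp (- c * wt t))"
      using bound[of t] wt_ge_1[of t]
      by (smt (verit) exp_gt_zero mult_right_mono mult_nonneg_nonneg zero_le_power)
    also have "\<dots> \<le> \<bar>B\<bar> * (K / wt t)"
      by (intro mult_left_mono K wt_ge_1) auto
    finally show ?thesis by simp
  qed
  then show "integrable lborel \<phi>"
    by (rule integrable_le_wt[OF assms(1)])
  show "\<exists>K\<ge>0. \<forall>t. \<bar>\<phi> t\<bar> \<le> K / wt t"
    using * K by (intro exI[of _ "\<bar>B\<bar> * K"]) auto
qed

lemma decayingE:
  assumes "x \<in> decaying"
  obtains c C where "c > 0" "\<And>t. pol x t \<le> C - c * wt t"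
  using assms by (auto simp: decaying_def)

lemma monom2_exp_pol_bound:
  assumes "x \<in> decaying"
  shows "integrable lborel (\<lambda>t. monom2 j t * exp (pol x t))"
    and "\<exists>K\<ge>0. \<forall>t. \<bar>monom2 j t * exp (pol x t)\<bar> \<le> K / wt t"
proof -
  obtain c C where c: "c > 0" and C: "\<And>t. pol x t \<le> C - c * wt t"
    using decayingE[OF assms] by blast
  have "\<bar>monom2 j t * exp (pol x t)\<bar> \<le> exp C * (wt t ^ mdeg j * exp (- c * wt t))" for t
  proof -
    have "\<bar>monom2 j t\<bar> * exp (pol x t) \<le> wt t ^ mdeg j * exp (C - c * wt t)"
      using C wt_ge_1[of t] by (intro mult_mono abs_monom2_le_wt_power) auto
    then show ?thesis by (simp add: abs_mult exp_diff exp_minus field_simps)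
  qed
  note * = integrable_wt_exp[OF _ c this]
  show "integrable lborel (\<lambda>t. monom2 j t * exp (pol x t))"
    by (rule *(1)) measurable
  show "\<exists>K\<ge>0. \<forall>t. \<bar>monom2 j t * exp (pol x t)\<bar> \<le> K / wt t"
    by (rule *(2)) measurable
qed

lemma integrable_exp_pol: "x \<in> decaying \<Longrightarrow> integrable lborel (\<lambda>t. exp (pol x t))"
  using monom2_exp_pol_bound(1)[of x "(0, 0)"] by (simp add: monom2_def)

text \<open>A change of \<open>x\<close> by \<open>h\<close> changes \<open>pol x\<close> by at most a multiple of \<open>norm h * wt\<close>, which for small \<open>h\<close>
  consumes only half of the decay.\<close>

lemma open_decaying: "open decaying"
  unfolding open_dist
proof (intro ballI)
  fix x assume "x \<in> decaying"
  then obtain c C where c: "c > 0" and C: "\<And>t. pol x t \<le> C - c * wt t"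
    using decayingE by blast
  let ?N = "real CARD(idx4)"
  have "y \<in> decaying" if y: "dist y x < c / (2 * ?N)" for y
  proof -
    have N: "?N * norm (y - x) \<le> c / 2"
      using y by (simp add: dist_norm field_simps)
    have "pol y t \<le> C - c / 2 * wt t" for t
    proof -
      have "pol y t = pol x t + pol (y - x) t" by (simp add: pol_diff)
      moreover have "pol (y - x) t \<le> ?N * norm (y - x) * wt t"
        using abs_pol_le_norm[of "y - x" t] by linarith
      moreover have "?N * norm (y - x) * wt t \<le> c / 2 * wt t"
        using N wt_ge_1[of t] by (intro mult_right_mono) auto
      ultimately show ?thesis using C[of t] by (simp add: algebra_simps)
    qed
    with c show ?thesis unfolding decaying_def
      by (intro CollectI exI[of _ "c / 2"] conjI exI[of _ C]) auto
  qed
  then show "\<exists>e>0. \<forall>y. dist y x < e \<longrightarrow> y \<in> decaying"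
    using c by (intro exI[of _ "c / (2 * ?N)"]) auto
qed

section \<open>Zeros of polynomials\<close>

lemma mi_Idx: "mdeg i \<le> 4 \<Longrightarrow> mi (Idx i) = i"
  by (simp add: Idx_inverse)

lemma pol_sum: "pol x t = (\<Sum>i | mdeg i \<le> 4. x $ Idx i * monom2 i t)"
  unfolding pol_def
  by (rule sum.reindex_bij_witness[of _ Idx mi]) (auto simp: mi_Idx mdeg_mi mi_inverse)

text \<open>A polynomial in \<open>t\<^sub>1\<close> whose coefficients are polynomials in \<open>t\<^sub>2\<close>, so that facts on polynomials in one
  variable apply twice.\<close>

lemma pol_nested_sum:
  "pol x t = (\<Sum>a\<le>4. (\<Sum>b\<le>4. (if a + b \<le> 4 then co x a b else 0) * snd t ^ b) * fst t ^ a)"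
proof -
  have "pol x t = (\<Sum>i\<in>{..4} \<times> {..4}. (if mdeg i \<le> 4 then x $ Idx i else 0) * monom2 i t)"
    unfolding pol_sum by (rule sum.mono_neutral_cong_left) (auto simp: mdeg_def)
  also have "\<dots> = (\<Sum>a\<le>4. \<Sum>b\<le>4. (if a + b \<le> 4 then co x a b else 0) * (fst t ^ a * snd t ^ b))"
    by (auto simp: sum.cartesian_product mdeg_def monom2_def intro!: sum.cong)
  finally show ?thesis
    by (simp add: sum_distrib_right sum_distrib_left mult_ac)
qed

lemma coeff_eq_0:
  assumes "\<And>b. b \<le> 4 \<Longrightarrow> \<forall>a\<le>4. (if a + b \<le> 4 then co x a b else 0) = 0"
  shows "x = 0"
proof -
  have "x $ i = 0" for i
  proof -
    obtain a b where ab: "mi i = (a, b)" by force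
    then have "a + b \<le> 4" using mdeg_mi[of i] by (simp add: mdeg_def)
    then have "co x a b = 0" using assms[of b] by (metis add_leD1 add_leD2)
    then show ?thesis using ab mi_inverse[of i] by simp
  qed
  then show ?thesis by (simp add: vec_eq_iff)
qed

lemma pol_eq_0_imp:
  assumes "\<And>t. pol x t = 0"
  shows "x = 0"
proof (rule coeff_eq_0, intro allI impI)
  fix a b :: nat assume "b \<le> 4" "a \<le> 4"
  let ?q = "\<lambda>a v. \<Sum>b\<le>4. (if a + b \<le> 4 then co x a b else 0) * v ^ b"
  have "\<forall>u. (\<Sum>a\<le>4. ?q a v * u ^ a) = 0" for v
  proof
    fix u
    show "(\<Sum>a\<le>4. ?q a v * u ^ a) = 0"
      using assms[of "(u, v)"] by (simp only: pol_nested_sum fst_conv snd_conv)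
  qed
  then have "\<forall>k\<le>4. ?q k v = 0" for v
    by (rule iffD1[OF Transcendental.polyfun_eq_0])
  then have "\<forall>v. ?q a v = 0"
    using \<open>a \<le> 4\<close> by blast
  then have "\<forall>k\<le>4. (if a + k \<le> 4 then co x a k else 0) = 0"
    by (rule iffD1[OF Transcendental.polyfun_eq_0])
  then show "(if a + b \<le> 4 then co x a b else 0) = 0"
    using \<open>b \<le> 4\<close> by blast
qed

text \<open>For all but finitely many \<open>v\<close> the polynomial \<open>pol x (u, v)\<close> in \<open>u\<close> is not zero, and then it
  has only finitely many zeros.\<close>

lemma pol_nonzero_AE:
  assumes "x \<noteq> 0"
  shows "AE t in lborel. pol x t \<noteq> 0"
proof -
  define q where "q = (\<lambda>a v. \<Sum>b\<le>4. (if a + b \<le> 4 then co x a b else 0) * v ^ b)"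
  have pol: "pol x (u, v) = (\<Sum>a\<le>4. q a v * u ^ a)" for u v
    unfolding pol_nested_sum q_def by simp
  have "\<exists>a\<le>4. \<exists>b\<le>4. (if a + b \<le> 4 then co x a b else 0) \<noteq> 0"
    using coeff_eq_0[of x] assms by blast
  then obtain a b where a: "a \<le> 4" and b: "b \<le> 4" and "(if a + b \<le> 4 then co x a b else 0) \<noteq> 0"
    by blast
  then have "\<exists>k\<le>4. (if a + k \<le> 4 then co x a k else 0) \<noteq> 0"
    using b by blast
  then have fin: "finite {v. q a v = 0}"
    unfolding q_def by (rule iffD2[OF Transcendental.polyfun_finite_roots])
  have sets: "{t. pol x t \<noteq> 0} \<in> sets (lborel \<Otimes>\<^sub>M lborel)"
    unfolding lborel_prod by measurable
  have slice: "AE u in lborel. pol x (u, v) \<noteq> 0" if v: "v \<notin> {v. q a v = 0}" for v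
  proof -
    have "finite {u. pol x (u, v) = 0}"
      unfolding pol using v a Transcendental.polyfun_rootbound[of "\<lambda>a. q a v" a 4] by auto
    then show ?thesis
      by (intro AE_I'[of "{u. pol x (u, v) = 0}"] finite_imp_null_set_lborel) auto
  qed
  have "AE v in lborel. v \<notin> {v. q a v = 0}"
    using fin by (intro AE_not_in finite_imp_null_set_lborel)
  then have "AE v in lborel. AE u in lborel. pol x (u, v) \<noteq> 0"
    by eventually_elim (rule slice)
  then have "AE u in lborel. AE v in lborel. pol x (u, v) \<noteq> 0"
    using sets by (subst lborel_pair.AE_commute) (simp_all add: space_pair_measure del: sets_pair_measure_cong)
  then have "AE t in lborel \<Otimes>\<^sub>M lborel. pol x t \<noteq> 0"
    using sets by (intro lborel_pair.AE_pair_measure) (simp_all add: space_pair_measure)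
  then show ?thesis by (simp only: lborel_prod)
qed

section \<open>Differentiation of the moments\<close>

lemma exp_remainder: "\<bar>exp y - 1 - y\<bar> \<le> y\<^sup>2 * exp \<bar>y\<bar>" for y :: real
proof -
  obtain s where s: "\<bar>s\<bar> \<le> \<bar>y\<bar>" "exp y = (\<Sum>m<2. y ^ m / fact m) + exp s / fact 2 * y ^ 2"
    using Maclaurin_exp_le by blast
  then have e: "exp y - 1 - y = exp s / 2 * y\<^sup>2"
    by (simp add: numeral_2_eq_2)
  have "exp s \<le> exp \<bar>y\<bar>" using s(1) by simp
  have "exp s / 2 * y\<^sup>2 \<le> exp \<bar>y\<bar> * y\<^sup>2"
  proof (rule mult_right_mono)
    show "exp s / 2 \<le> exp \<bar>y\<bar>"
      using \<open>exp s \<le> exp \<bar>y\<bar>\<close> exp_gt_zero[of "\<bar>y\<bar>"] by linarith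
  qed simp
  then show ?thesis
    unfolding e by (simp add: abs_mult mult.commute)
qed

text \<open>The set where \<open>\<phi>\<close> is not zero is open and null.\<close>

lemma integral_nonneg_continuous_eq_0:
  fixes \<phi> :: "'a :: euclidean_space \<Rightarrow> real"
  assumes int: "integrable lborel \<phi>" and cont: "continuous_on UNIV \<phi>"
    and nonneg: "\<And>t. 0 \<le> \<phi> t" and zero: "(LINT t|lborel. \<phi> t) = 0"
  shows "\<phi> t = 0"
proof -
  have "AE t in lborel. \<phi> t = 0"
    using integral_nonneg_eq_0_iff_AE[OF int] nonneg zero by simp
  then have "AE t in lebesgue. \<phi> t = 0"
    by (rule AE_completion)
  then have "negligible {t. \<phi> t \<noteq> 0}"
    by (simp add: AE_iff_null_sets negligible_iff_null_sets eventually_ae_filter)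
       (metis (no_types, lifting) Collect_mono_iff UNIV_I null_sets_completion_iff2 null_sets_completion_subset)
  moreover have "open {t. \<phi> t \<noteq> 0}"
    using cont by (intro open_Collect_neq continuous_intros)
  ultimately show ?thesis
    using open_not_negligible by blast
qed

text \<open>The integrand of the second-order remainder of \<open>h \<mapsto> mom (x + h) j\<close> is at most \<open>\<bar>h\<bar>\<^sup>2\<close> times
  a fixed integrable function, because \<open>pol x + \<bar>pol h\<bar> \<le> C - c / 2 * wt\<close> for small \<open>h\<close>.\<close>

lemma mom_remainder:
  assumes "x \<in> decaying"
  obtains d B where "d > 0"
    "\<And>y. dist y x < d \<Longrightarrow>
       \<bar>mom y j - mom x j - (\<Sum>k\<in>UNIV. (y - x) $ k * mom x (j + mi k))\<bar> \<le> B * (norm (y - x))\<^sup>2"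
proof -
  obtain c C where c: "c > 0" and C: "\<And>t. pol x t \<le> C - c * wt t"
    using decayingE[OF assms] by blast
  obtain e where e: "e > 0" "\<And>y. dist y x < e \<Longrightarrow> y \<in> decaying"
    using open_decaying assms unfolding open_dist by blast
  let ?N = "real CARD(idx4)"
  let ?m = "mdeg j + 2"
  define D where "D = (\<lambda>t. wt t ^ ?m * exp (- (c / 2) * wt t))"
  have D: "integrable lborel D"
    unfolding D_def
    by (rule integrable_wt_exp(1)[of _ "c / 2" 1 ?m]) (use c wt_ge_1 in \<open>auto simp: abs_mult order_trans[OF zero_le_one]\<close>)
  define B where "B = ?N\<^sup>2 * exp C * (LINT t|lborel. D t)"
  define d where "d = min e (c / (2 * ?N))"
  have bound: "\<bar>mom y j - mom x j - (\<Sum>k\<in>UNIV. (y - x) $ k * mom x (j + mi k))\<bar>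
      \<le> B * (norm (y - x))\<^sup>2" if y: "dist y x < d" for y
  proof -
    define h where "h = y - x"
    have N: "?N * norm h \<le> c / 2"
      using y by (simp add: dist_norm d_def h_def field_simps)
    have ydec: "y \<in> decaying" using e y by (simp add: d_def)
    let ?R = "\<lambda>t. monom2 j t * exp (pol x t) * (exp (pol h t) - 1 - pol h t)"
    have split: "?R t = monom2 j t * exp (pol y t) - monom2 j t * exp (pol x t)
        - (\<Sum>k\<in>UNIV. h $ k * (monom2 (j + mi k) t * exp (pol x t)))" for t
    proof -
      have "(\<Sum>k\<in>UNIV. h $ k * (monom2 (j + mi k) t * exp (pol x t))) = monom2 j t * exp (pol x t) * pol h t"
        by (simp add: pol_def[of h] monom2_add sum_distrib_left mult_ac)
      moreover have "exp (pol y t) = exp (pol x t) * exp (pol h t)"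
        by (simp add: h_def pol_diff exp_diff)
      ultimately show ?thesis by (simp add: algebra_simps)
    qed
    note ints = monom2_exp_pol_bound(1)[OF assms] monom2_exp_pol_bound(1)[OF ydec]
    have R_int: "integrable lborel ?R"
      unfolding split by (intro Bochner_Integration.integrable_diff Bochner_Integration.integrable_sum integrable_mult_right ints)
    have "(LINT t|lborel. ?R t) = mom y j - mom x j - (\<Sum>k\<in>UNIV. h $ k * mom x (j + mi k))"
      unfolding split mom_def by (simp add: ints)
    moreover have "\<bar>LINT t|lborel. ?R t\<bar> \<le> (LINT t|lborel. ?N\<^sup>2 * (norm h)\<^sup>2 * exp C * D t)"
    proof (rule order_trans[OF integral_abs_bound], rule integral_mono)
      fix t
      have ph: "\<bar>pol h t\<bar> \<le> ?N * norm h * wt t" by (rule abs_pol_le_norm)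
      also have "\<dots> \<le> c / 2 * wt t" using N wt_ge_1[of t] by (intro mult_right_mono) auto
      finally have ph2: "\<bar>pol h t\<bar> \<le> c / 2 * wt t" .
      have sq: "(pol h t)\<^sup>2 \<le> (?N * norm h * wt t)\<^sup>2"
        using ph wt_ge_1[of t] by (intro abs_le_square_iff[THEN iffD1]) auto
      have "\<bar>?R t\<bar> \<le> wt t ^ mdeg j * exp (C - c * wt t) * ((?N * norm h * wt t)\<^sup>2 * exp (c / 2 * wt t))"
        unfolding abs_mult
        using C wt_ge_1[of t] sq ph2
        by (intro mult_mono abs_monom2_le_wt_power order_trans[OF exp_remainder]) auto
      also have "\<dots> = wt t ^ mdeg j * (?N * norm h * wt t)\<^sup>2 * (exp (C - c * wt t) * exp (c / 2 * wt t))"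
        by (simp only: mult_ac)
      also have "exp (C - c * wt t) * exp (c / 2 * wt t) = exp C * exp (- (c / 2) * wt t)"
        by (simp add: exp_add[symmetric] algebra_simps)
      also have "wt t ^ mdeg j * (?N * norm h * wt t)\<^sup>2 * (exp C * exp (- (c / 2) * wt t))
          = ?N\<^sup>2 * (norm h)\<^sup>2 * exp C * D t"
        by (simp only: D_def power_mult_distrib power_add mult_ac)
      finally show "\<bar>?R t\<bar> \<le> ?N\<^sup>2 * (norm h)\<^sup>2 * exp C * D t" .
    qed (use D R_int in auto)
    ultimately show ?thesis
      by (simp add: B_def h_def mult_ac)
  qed
  show ?thesis
    by (rule that[of d B]) (use c e bound in \<open>auto simp: d_def\<close>)
qed

lemma has_derivative_mom:
  assumes "x \<in> decaying"
  shows "((\<lambda>y. mom y j) has_derivative (\<lambda>h. \<Sum>k\<in>UNIV. h $ k * mom x (j + mi k))) (at x)"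
proof -
  obtain d B where d: "d > 0" and B: "\<And>y. dist y x < d \<Longrightarrow>
       \<bar>mom y j - mom x j - (\<Sum>k\<in>UNIV. (y - x) $ k * mom x (j + mi k))\<bar> \<le> B * (norm (y - x))\<^sup>2"
    using mom_remainder[OF assms] by metis
  show ?thesis
  proof (rule has_derivativeI_sandwich[OF d])
    show "bounded_linear (\<lambda>h. \<Sum>k\<in>UNIV. h $ k * mom x (j + mi k))"
      by (intro bounded_linear_sum bounded_linear_mult_const bounded_linear_vec_nth)
    show "norm (mom y j - mom x j - (\<Sum>k\<in>UNIV. (y - x) $ k * mom x (j + mi k))) / norm (y - x)
        \<le> B * norm (y - x)" if "y \<noteq> x" "dist y x < d" for y
      using B[OF that(2)] that(1) by (simp add: pos_divide_le_eq power2_eq_square)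
    have "((\<lambda>y. B * norm (y - x)) \<longlongrightarrow> B * norm (x - x)) (at x)"
      by (intro tendsto_intros)
    then show "((\<lambda>y. B * norm (y - x)) \<longlongrightarrow> 0) (at x)" by simp
  qed
qed

definition momvec :: "real ^ idx4 \<Rightarrow> real ^ idx4" where
  "momvec x = (\<chi> i. mom x (mi i))"

definition hess :: "real ^ idx4 \<Rightarrow> real ^ idx4 ^ idx4" where
  "hess x = (\<chi> i j. mom x (mi i + mi j))"

lemma has_derivative_momvec:
  assumes "x \<in> decaying"
  shows "(momvec has_derivative (\<lambda>h. hess x *v h)) (at x)"
  unfolding has_derivative_componentwise_within[of momvec]
proof
  fix b :: "real ^ idx4" assume "b \<in> Basis"
  then obtain i where b: "b = axis i 1" by (auto simp: Basis_vec_def)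
  show "((\<lambda>y. momvec y \<bullet> b) has_derivative (\<lambda>h. (hess x *v h) \<bullet> b)) (at x)"
    using has_derivative_mom[OF assms, of "mi i"]
    by (simp add: b inner_axis momvec_def hess_def matrix_vector_mult_def mult.commute)
qed

lemma continuous_momvec: "continuous_on decaying momvec"
  using has_derivative_continuous[OF has_derivative_momvec]
  by (simp add: continuous_at_imp_continuous_on)

text \<open>As the Gram matrix of the monomials in \<open>L\<^sup>2\<close> of the measure with density \<open>exp (pol x)\<close>, the
  matrix \<open>hess x\<close> is positive definite.\<close>

lemma hess_quadratic_form:
  assumes "x \<in> decaying"
  shows "integrable lborel (\<lambda>t. (pol h t)\<^sup>2 * exp (pol x t))"
    and "h \<bullet> (hess x *v h) = (LINT t|lborel. (pol h t)\<^sup>2 * exp (pol x t))"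
proof -
  have eq: "(pol h t)\<^sup>2 * exp (pol x t)
      = (\<Sum>i\<in>UNIV. \<Sum>j\<in>UNIV. h $ i * (monom2 (mi i + mi j) t * exp (pol x t) * h $ j))" for t
    by (simp add: pol_def[of h] power2_eq_square sum_product sum_distrib_left sum_distrib_right monom2_add mult_ac)
  note ints = monom2_exp_pol_bound(1)[OF assms]
  show "integrable lborel (\<lambda>t. (pol h t)\<^sup>2 * exp (pol x t))"
    unfolding eq
    by (intro Bochner_Integration.integrable_sum integrable_mult_right integrable_mult_left ints)
  show "h \<bullet> (hess x *v h) = (LINT t|lborel. (pol h t)\<^sup>2 * exp (pol x t))"
    unfolding eq
    by (simp add: ints inner_vec_def matrix_vector_mult_def hess_def mom_def sum_distrib_left)
qed

lemma invertible_hess: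
  assumes "x \<in> decaying"
  shows "invertible (hess x)"
proof -
  have "h = 0" if "hess x *v h = 0" for h
  proof (rule pol_eq_0_imp)
    fix t
    have "(pol h t)\<^sup>2 * exp (pol x t) = 0"
      by (rule integral_nonneg_continuous_eq_0[OF hess_quadratic_form(1)[OF assms]])
         (use that hess_quadratic_form(2)[OF assms, of h] in \<open>auto intro!: continuous_intros\<close>)
    then show "pol h t = 0" by simp
  qed
  then show ?thesis
    by (simp add: invertible_left_inverse matrix_left_invertible_ker)
qed

lemma pol_eq_iff: "(\<forall>t. pol x t = pol y t) \<longleftrightarrow> x = y"
  using pol_eq_0_imp[of "x - y"] by (auto simp: pol_diff)

text \<open>If \<open>momvec x = momvec y\<close>, then the integral of the nonnegative function
  \<open>(pol x - pol y) * (exp (pol x) - exp (pol y))\<close> is zero.\<close>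

lemma inj_on_momvec: "inj_on momvec decaying"
proof (rule inj_onI)
  fix x y assume x: "x \<in> decaying" and y: "y \<in> decaying" and eq: "momvec x = momvec y"
  let ?f = "\<lambda>t. (pol x t - pol y t) * (exp (pol x t) - exp (pol y t))"
  have f: "?f t = (\<Sum>k\<in>UNIV. (x - y) $ k * (monom2 (mi k) t * exp (pol x t) - monom2 (mi k) t * exp (pol y t)))" for t
    unfolding pol_diff[symmetric]
    by (simp add: pol_def[of "x - y"] sum_distrib_left sum_distrib_right algebra_simps)
  note ints = monom2_exp_pol_bound(1)[OF x] monom2_exp_pol_bound(1)[OF y]
  have int: "integrable lborel ?f"
    unfolding f by (intro Bochner_Integration.integrable_sum integrable_mult_right Bochner_Integration.integrable_diff ints)
  have "mom x (mi k) = mom y (mi k)" for k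
    using eq by (simp add: momvec_def vec_eq_iff)
  then have zero: "(LINT t|lborel. ?f t) = 0"
    unfolding f by (simp add: ints mom_def)
  have "?f t = 0" for t
  proof (rule integral_nonneg_continuous_eq_0[OF int _ _ zero])
    show "continuous_on UNIV ?f" by (intro continuous_intros)
    show "0 \<le> ?f t" for t
      by (cases "pol x t \<le> pol y t") (auto intro: mult_nonpos_nonpos mult_nonneg_nonneg)
  qed
  then have "pol x t = pol y t" for t by auto
  then show "x = y" using pol_eq_iff by blast
qed

section \<open>The maximizer\<close>

text \<open>As an extended nonnegative number, since off \<open>decaying\<close> the integral can be infinite.\<close>

definition exp_integral :: "real ^ idx4 \<Rightarrow> ennreal" where
  "exp_integral x = (\<integral>\<^sup>+ t. ennreal (exp (pol x t)) \<partial>lborel)"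

lemma L0_eq: "L0 g x = ereal (g \<bullet> x) - enn2ereal (exp_integral x)"
  by (simp add: L0_def exp_integral_def pol_def inner_vec_def nn_integral_completion)

lemma exp_integral_decaying:
  assumes "x \<in> decaying"
  shows "exp_integral x = ennreal (mom x (0, 0))"
  unfolding exp_integral_def mom_def
  by (subst nn_integral_eq_integral) (auto simp: monom2_def integrable_exp_pol[OF assms])

lemma L0_decaying: "x \<in> decaying \<Longrightarrow> L0 g x = ereal (g \<bullet> x - mom x (0, 0))"
  by (simp add: L0_eq exp_integral_decaying enn2ereal_ennreal mom_def monom2_def)

lemma ge_L0_iff: "ereal c \<le> L0 g x \<longleftrightarrow> exp_integral x \<le> ennreal (g \<bullet> x - c) \<and> c \<le> g \<bullet> x"
proof (cases "exp_integral x" rule: ennreal_cases)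
  case (real r)
  then show ?thesis by (auto simp: L0_eq enn2ereal_ennreal ennreal_le_iff2)
qed (simp add: L0_eq top_unique)

lemma ex_decaying: "\<exists>x. x \<in> decaying"
proof -
  define x :: "real ^ idx4" where
    "x = (\<chi> i. if i = Idx (4, 0) \<or> i = Idx (0, 4) then -1 else 0)"
  have ne: "Idx (4, 0) \<noteq> Idx (0, 4)"
    by (simp add: Idx_inject mdeg_def)
  have "pol x t = 1 - wt t" for t
  proof -
    have "pol x t = (\<Sum>i\<in>{Idx (4, 0), Idx (0, 4)}. - monom2 (mi i) t)"
      unfolding pol_def by (rule sum.mono_neutral_cong_right) (auto simp: x_def)
    then show ?thesis
      using ne by (simp add: mi_Idx mdeg_def monom2_def wt_def)
  qed
  then have "x \<in> decaying"
    unfolding decaying_def by (intro CollectI exI[of _ 1] conjI exI[of _ 1]) auto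
  then show ?thesis ..
qed

text \<open>\<open>L0 g\<close> is upper semicontinuous, because the integral is lower semicontinuous by Fatou's lemma.\<close>

lemma closed_superlevel: "closed {x. ereal c \<le> L0 g x}"
  unfolding closed_sequential_limits
proof (intro allI impI, elim conjE)
  fix X x assume X: "\<forall>n. X n \<in> {x. ereal c \<le> L0 g x}" and lim: "X \<longlonglongrightarrow> x"
  have Zn: "exp_integral (X n) \<le> ennreal (g \<bullet> X n - c)" and cn: "c \<le> g \<bullet> X n" for n
    using X by (auto simp: ge_L0_iff)
  have lin: "(\<lambda>n. g \<bullet> X n) \<longlonglongrightarrow> g \<bullet> x"
    by (intro tendsto_intros lim)
  have "(\<lambda>n. pol (X n) t) \<longlonglongrightarrow> pol x t" for t
    unfolding pol_def by (intro tendsto_intros lim)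
  then have exp: "(\<lambda>n. ennreal (exp (pol (X n) t))) \<longlonglongrightarrow> ennreal (exp (pol x t))" for t
    by (intro tendsto_intros) auto
  have "exp_integral x = (\<integral>\<^sup>+ t. liminf (\<lambda>n. ennreal (exp (pol (X n) t))) \<partial>lborel)"
    unfolding exp_integral_def using lim_imp_Liminf[OF _ exp] by simp
  also have "\<dots> \<le> liminf (\<lambda>n. exp_integral (X n))"
    unfolding exp_integral_def by (rule nn_integral_liminf) measurable
  also have "\<dots> \<le> liminf (\<lambda>n. ennreal (g \<bullet> X n - c))"
    by (intro Liminf_mono always_eventually allI Zn)
  also have "\<dots> = ennreal (g \<bullet> x - c)"
    by (intro lim_imp_Liminf tendsto_ennrealI tendsto_diff lin tendsto_const) simp
  finally have "exp_integral x \<le> ennreal (g \<bullet> x - c)" .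
  moreover have "c \<le> g \<bullet> x"
    using LIMSEQ_le_const[OF lin] cn by blast
  ultimately show "x \<in> {x. ereal c \<le> L0 g x}"
    by (simp add: ge_L0_iff)
qed

text \<open>The scalar product \<open>g \<bullet> x\<close> is the integral of \<open>pol x\<close> against the density. A density is positive on a
  set of positive measure, whereas the zeros of \<open>pol x\<close> form a null set.\<close>

lemma density_inner_neg:
  assumes "has_representing_density g" and nonpos: "\<And>t. pol x t \<le> 0" and "x \<noteq> 0"
  shows "g \<bullet> x < 0"
proof -
  obtain f :: "real \<times> real \<Rightarrow> real" where f [measurable]: "f \<in> borel_measurable lebesgue"
    and f0: "AE t in lebesgue. 0 \<le> f t" and fne: "\<not> (AE t in lebesgue. f t = 0)"
    and fi: "\<And>i. integrable lebesgue (\<lambda>t. \<bar>monom2 (mi i) t\<bar> * f t)"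
    and fg: "\<And>i. (LINT t|lebesgue. monom2 (mi i) t * f t) = g $ i"
    using assms(1) unfolding has_representing_density_def by blast
  have [measurable]: "monom2 j \<in> borel_measurable lebesgue" for j
    by (intro measurable_completion) simp
  have ints: "integrable lebesgue (\<lambda>t. monom2 (mi i) t * f t)" for i
    by (rule Bochner_Integration.integrable_bound[OF fi[of i]]) (auto simp: abs_mult)
  have eq: "pol x t * f t = (\<Sum>i\<in>UNIV. x $ i * (monom2 (mi i) t * f t))" for t
    by (simp add: pol_def sum_distrib_right mult.assoc)
  have int: "integrable lebesgue (\<lambda>t. pol x t * f t)"
    unfolding eq by (intro Bochner_Integration.integrable_sum integrable_mult_right ints)
  have gx: "(LINT t|lebesgue. pol x t * f t) = g \<bullet> x"
    unfolding eq by (subst Bochner_Integration.integral_sum)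
      (simp_all add: ints fg inner_vec_def mult.commute[of "x $ _"])
  have AE0: "AE t in lebesgue. 0 \<le> - (pol x t * f t)"
    using f0 by eventually_elim (use nonpos in \<open>simp add: mult_nonpos_nonneg\<close>)
  have "g \<bullet> x \<le> 0"
    using integral_nonneg_AE[OF AE0] gx by simp
  moreover have "g \<bullet> x \<noteq> 0"
  proof
    assume "g \<bullet> x = 0"
    then have "(LINT t|lebesgue. - (pol x t * f t)) = 0" using gx by simp
    then have "AE t in lebesgue. - (pol x t * f t) = 0"
      using integral_nonneg_eq_0_iff_AE[OF _ AE0] int by simp
    moreover have "AE t in lebesgue. pol x t \<noteq> 0"
      by (intro AE_completion pol_nonzero_AE \<open>x \<noteq> 0\<close>)
    ultimately have "AE t in lebesgue. f t = 0"
      by eventually_elim simp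
    with fne show False ..
  qed
  ultimately show ?thesis by simp
qed

lemma continuous_pol_joint: "continuous_on UNIV (\<lambda>(x, t). pol x t)"
  unfolding pol_def monom2_def case_prod_unfold
  by (intro continuous_intros)

text \<open>Along a sequence in a superlevel set with \<open>\<bar>x\<^sub>n\<bar> \<rightarrow> \<infinity>\<close> whose directions converge to \<open>u\<close>, the
  polynomial \<open>pol u\<close> is positive somewhere, and then the integral grows exponentially, or it is
  nowhere positive, and then the linear part tends to \<open>-\<infinity>\<close>.\<close>

lemma bounded_superlevel:
  assumes g: "has_representing_density g"
  shows "bounded {x. ereal c \<le> L0 g x}"
proof (rule ccontr)
  assume "\<not> ?thesis"
  then have "\<forall>n::nat. \<exists>x. ereal c \<le> L0 g x \<and> norm x > real n"
    unfolding bounded_iff by (meson mem_Collect_eq not_le)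
  then obtain X where X: "\<And>n. ereal c \<le> L0 g (X n)" and XN: "\<And>n. norm (X n) > real n"
    by metis
  define U where "U n = X n /\<^sub>R norm (X n)" for n
  have X0: "norm (X n) > 0" for n using XN[of n] by (meson le_less_trans of_nat_0_le_iff)
  have "U n \<in> sphere 0 1" for n using X0[of n] by (simp add: U_def)
  then obtain u r where r: "strict_mono (r :: nat \<Rightarrow> nat)" and u: "u \<in> sphere 0 1"
      and lim: "(U \<circ> r) \<longlonglongrightarrow> u"
    using compact_sphere[of "0 :: real ^ idx4" 1] unfolding compact_def by metis
  define R where "R n = norm (X (r n))" for n
  have Xr: "X (r n) = R n *\<^sub>R U (r n)" for n
    using X0[of "r n"] by (simp add: R_def U_def)
  have R: "filterlim R at_top sequentially"
  proof (rule filterlim_at_top_mono)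
    show "filterlim (\<lambda>n. real n) at_top sequentially" by (rule filterlim_real_sequentially)
    show "\<forall>\<^sub>F n in sequentially. real n \<le> R n"
    proof (rule always_eventually, rule allI)
      fix n show "real n \<le> R n"
        using XN[of "r n"] seq_suble[OF r, of n] unfolding R_def by linarith
    qed
  qed
  have lin: "(\<lambda>n. g \<bullet> U (r n)) \<longlonglongrightarrow> g \<bullet> u"
    using lim unfolding o_def by (intro tendsto_intros)
  have Zn: "exp_integral (X (r n)) \<le> ennreal (R n * (g \<bullet> U (r n)) - c)" and cn: "c \<le> R n * (g \<bullet> U (r n))" for n
    using X[of "r n"] by (auto simp: ge_L0_iff Xr)
  show False
  proof (cases "\<exists>t. pol u t > 0")
    case False
    then have "g \<bullet> u < 0"
      using density_inner_neg[OF g, of u] u by (force simp: not_less)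
    then have "filterlim (\<lambda>n. (g \<bullet> U (r n)) * R n) at_bot sequentially"
      by (rule filterlim_tendsto_neg_mult_at_bot[OF lin _ R])
    then have "\<forall>\<^sub>F n in sequentially. (g \<bullet> U (r n)) * R n < c"
      by (simp add: filterlim_at_bot_dense)
    then obtain n where "(g \<bullet> U (r n)) * R n < c"
      unfolding eventually_sequentially by blast
    with cn[of n] show False by (simp add: mult.commute)
  next
    case True
    then obtain t0 where t0: "pol u t0 > 0" by blast
    define e where "e = pol u t0 / 2"
    have e: "e > 0" "pol u t0 > e" using t0 by (auto simp: e_def)
    have "open {p. e < (\<lambda>(x, t). pol x t) p}"
      by (intro open_Collect_less continuous_on_const continuous_pol_joint)
    moreover have "(u, t0) \<in> {p. e < (\<lambda>(x, t). pol x t) p}" using e by simp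
    ultimately obtain A B where AB: "open A" "open B" "u \<in> A" "t0 \<in> B"
        "A \<times> B \<subseteq> {p. e < (\<lambda>(x, t). pol x t) p}"
      by (rule open_prod_elim) blast
    obtain \<rho> where \<rho>: "\<rho> > 0" "ball t0 \<rho> \<subseteq> B"
      using AB(2,4) openE by blast
    define m where "m = measure lborel (ball t0 \<rho>)"
    have m: "emeasure lborel (ball t0 \<rho>) = ennreal m" "m > 0"
      using \<rho>(1) emeasure_lborel_ball_finite[of t0 \<rho>]
      by (simp_all add: m_def emeasure_eq_ennreal_measure content_ball_pos less_top)
    have ev: "\<forall>\<^sub>F n in sequentially. U (r n) \<in> A"
      using topological_tendstoD[OF lim AB(1,3)] by simp
    have grow: "m * exp (R n * e) \<le> R n * (g \<bullet> U (r n)) - c" if n: "U (r n) \<in> A" for n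
    proof -
      have "ennreal (m * exp (R n * e)) = (\<integral>\<^sup>+ t. ennreal (exp (R n * e)) * indicator (ball t0 \<rho>) t \<partial>lborel)"
        using m by (simp add: nn_integral_cmult_indicator ennreal_mult' mult.commute[of m])
      also have "\<dots> \<le> exp_integral (X (r n))"
        unfolding exp_integral_def
      proof (rule nn_integral_mono)
        fix t
        have "R n * e \<le> pol (X (r n)) t" if "t \<in> ball t0 \<rho>"
        proof -
          have "t \<in> B" using \<rho>(2) that by blast
          then have "e < pol (U (r n)) t"
            using subsetD[OF AB(5), of "(U (r n), t)"] n by simp
          then show ?thesis
            using X0[of "r n"] unfolding Xr pol_scale by (intro mult_left_mono) (auto simp: R_def)
        qed
        then show "ennreal (exp (R n * e)) * indicator (ball t0 \<rho>) t \<le> ennreal (exp (pol (X (r n)) t))"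
          by (auto simp: indicator_def intro!: ennreal_leI)
      qed
      also note Zn[of n]
      finally show ?thesis using cn[of n] by (simp add: ennreal_le_iff)
    qed
    have upper: "g \<bullet> U (r n) \<le> norm g" for n
      using norm_cauchy_schwarz[of g "U (r n)"] X0[of "r n"] by (simp add: U_def)
    \<comment> \<open>By \<open>e\<^sup>z \<ge> z\<^sup>2 / 2\<close> the exponential exceeds \<open>a R\<^sup>2\<close>, which for large \<open>R\<close> exceeds the linear terms.\<close>
    define a where "a = m * e\<^sup>2 / 2"
    have a: "a > 0" using m e by (simp add: a_def)
    have "\<forall>\<^sub>F n in sequentially. R n > max 1 ((norm g + \<bar>c\<bar>) / a)"
      using R unfolding filterlim_at_top_dense by blast
    then have "\<forall>\<^sub>F n in sequentially. m * exp (R n * e) - R n * norm g > - c"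
    proof eventually_elim
      case (elim n)
      have "1 + R n * e + (R n * e)\<^sup>2 / 2 \<le> exp (R n * e)"
        using elim e by (intro exp_lower_Taylor_quadratic) auto
      then have "(R n * e)\<^sup>2 / 2 < exp (R n * e)"
        using elim e by (smt (verit) mult_nonneg_nonneg max.bounded_iff)
      then have "m * ((R n * e)\<^sup>2 / 2) < m * exp (R n * e)" using m by simp
      moreover have "m * ((R n * e)\<^sup>2 / 2) = R n * (a * R n)"
        by (simp add: a_def power2_eq_square)
      moreover have "R n * (norm g + \<bar>c\<bar>) \<le> R n * (a * R n)"
        using elim a by (intro mult_left_mono) (auto simp: pos_divide_less_eq mult.commute)
      moreover have "\<bar>c\<bar> \<le> R n * \<bar>c\<bar>"
        using elim mult_right_mono[of 1 "R n" "\<bar>c\<bar>"] by simp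
      ultimately show ?case by (simp add: algebra_simps)
    qed
    with ev have "\<forall>\<^sub>F n in sequentially. False"
    proof eventually_elim
      case (elim n)
      have "R n * (g \<bullet> U (r n)) \<le> R n * norm g"
        using upper X0[of "r n"] by (intro mult_left_mono) (auto simp: R_def)
      with grow[OF elim(1)] elim(2) show False by linarith
    qed
    then show False by simp
  qed
qed

text \<open>The superlevel sets through the points above a fixed one are compact and totally ordered by
  inclusion; every point of their intersection is a maximizer.\<close>

lemma ex_L0_maximizer:
  assumes g: "has_representing_density g"
  shows "\<exists>x. L0 g x \<noteq> - \<infinity> \<and> (\<forall>y. L0 g y \<le> L0 g x)"
proof -
  let ?K = "\<lambda>z. {x. L0 g z \<le> L0 g x}"
  obtain w where "w \<in> decaying" using ex_decaying by blast
  then have w: "L0 g w \<noteq> - \<infinity>"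
    by (simp add: L0_decaying)
  have fin: "\<exists>c. L0 g z = ereal c" if "L0 g w \<le> L0 g z" for z
    using that w by (cases "exp_integral z" rule: ennreal_cases) (auto simp: L0_eq)
  have K: "closed (?K z)" "bounded (?K z)" if "L0 g w \<le> L0 g z" for z
    using fin[OF that] closed_superlevel[of _ g] bounded_superlevel[OF g] by auto
  have "?K w \<inter> \<Inter> (?K ` ?K w) \<noteq> {}"
  proof (rule compact_imp_fip)
    show "compact (?K w)" using K[of w] by (simp add: compact_eq_bounded_closed)
    show "closed T" if "T \<in> ?K ` ?K w" for T using that K by auto
    fix F assume F: "finite F" "F \<subseteq> ?K ` ?K w"
    then obtain Y where Y: "finite Y" "Y \<subseteq> ?K w" "F = ?K ` Y"
      by (meson finite_subset_image)
    obtain z where z: "z \<in> insert w Y" "L0 g z = Max (L0 g ` insert w Y)"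
      using Y(1) Max_in[of "L0 g ` insert w Y"] by fastforce
    have "L0 g y \<le> L0 g z" if "y \<in> insert w Y" for y
      using Y(1) that z(2) by (metis Max_ge finite.insertI finite_imageI imageI)
    then have "z \<in> ?K w \<inter> \<Inter>F" using Y by auto
    then show "?K w \<inter> \<Inter>F \<noteq> {}" by blast
  qed
  then obtain x where x: "L0 g w \<le> L0 g x" "\<And>z. L0 g w \<le> L0 g z \<Longrightarrow> L0 g z \<le> L0 g x"
    by blast
  then have "L0 g y \<le> L0 g x" for y by (metis linear order_trans)
  moreover have "L0 g x \<noteq> - \<infinity>" using w x(1) by auto
  ultimately show ?thesis by blast
qed

text \<open>At the midpoint of \<open>x\<close> and \<open>y\<close> the integrand is smaller than the mean of those at \<open>x\<close> and
  \<open>y\<close> by half the square of \<open>exp (pol x / 2) - exp (pol y / 2)\<close>.\<close>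

lemma L0_maximizer_unique:
  assumes fin: "L0 g x \<noteq> - \<infinity>" and x: "\<And>z. L0 g z \<le> L0 g x" and y: "\<And>z. L0 g z \<le> L0 g y"
  shows "x = y"
proof -
  have eq: "L0 g x = L0 g y" using x y by (simp add: antisym)
  define z where "z = (1 / 2) *\<^sub>R (x + y)"
  have int: "integrable lborel (\<lambda>t. exp (pol v t)) \<and> exp_integral v = ennreal (LINT t|lborel. exp (pol v t))"
    if "L0 g v \<noteq> - \<infinity>" for v
  proof -
    have "exp_integral v < \<infinity>" using that by (cases "exp_integral v" rule: ennreal_cases) (auto simp: L0_eq)
    then have "integrable lborel (\<lambda>t. exp (pol v t))"
      unfolding exp_integral_def by (intro integrableI_bounded) auto
    then show ?thesis by (simp add: exp_integral_def nn_integral_eq_integral)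
  qed
  let ?I = "\<lambda>v. LINT t|lborel. exp (pol v t)"
  note ix = int[OF fin] and iy = int[OF fin[unfolded eq]]
  let ?f = "\<lambda>t. (exp (pol x t / 2) - exp (pol y t / 2))\<^sup>2 / 2"
  have f: "exp (pol z t) = (exp (pol x t) + exp (pol y t)) / 2 - ?f t" for t
  proof -
    have "exp (pol z t) = exp (pol x t / 2) * exp (pol y t / 2)"
      by (simp add: z_def pol_scale pol_add exp_add[symmetric] add_divide_distrib)
    moreover have "exp (pol v t) = (exp (pol v t / 2))\<^sup>2" for v
      by (simp add: power2_eq_square exp_add[symmetric])
    ultimately show ?thesis by (simp add: power2_eq_square field_simps)
  qed
  have le: "exp (pol z t) \<le> (exp (pol x t) + exp (pol y t)) / 2" for t
    unfolding f by (simp only: diff_le_eq le_add_same_cancel1) simp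
  have intz: "integrable lborel (\<lambda>t. exp (pol z t))"
    by (rule Bochner_Integration.integrable_bound[of _ "\<lambda>t. (exp (pol x t) + exp (pol y t)) / 2"])
       (use ix iy le in auto)
  have intf: "integrable lborel ?f"
  proof -
    have "?f t = (exp (pol x t) + exp (pol y t)) / 2 - exp (pol z t)" for t using f by simp
    then show ?thesis using ix iy intz by simp
  qed
  define J where "J = (LINT t|lborel. ?f t)"
  have Iz: "?I z = (?I x + ?I y) / 2 - J"
    unfolding f J_def using ix iy intf by simp
  have L: "L0 g v = ereal (g \<bullet> v - ?I v)" if "integrable lborel (\<lambda>t. exp (pol v t))" for v
    using that by (simp add: L0_eq exp_integral_def nn_integral_eq_integral enn2ereal_ennreal)
  have "g \<bullet> z - ?I z \<le> g \<bullet> x - ?I x"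
    using x[of z] L[OF intz] L[of x] ix by simp
  moreover have "g \<bullet> x - ?I x = g \<bullet> y - ?I y"
    using eq L[of x] L[of y] ix iy by simp
  moreover have "g \<bullet> z = (g \<bullet> x + g \<bullet> y) / 2"
    by (simp add: z_def inner_add_right)
  ultimately have "J \<le> 0"
    using Iz by argo
  moreover have "J \<ge> 0" by (simp add: J_def)
  ultimately have zero: "(LINT t|lborel. ?f t) = 0" unfolding J_def by (rule antisym)
  have "?f t = 0" for t
    by (rule integral_nonneg_continuous_eq_0[OF intf _ _ zero]) (auto intro!: continuous_intros)
  then have "pol x t = pol y t" for t by auto
  then show ?thesis using pol_eq_iff by blast
qed

lemma lambda_star_maximizes:
  assumes "has_representing_density g"
  shows "L0 g y \<le> L0 g (lambda_star g)"
proof -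
  obtain x where x: "L0 g x \<noteq> - \<infinity>" "\<forall>y. L0 g y \<le> L0 g x"
    using ex_L0_maximizer[OF assms] by blast
  have "\<forall>y. L0 g y \<le> L0 g (THE x. \<forall>y. L0 g y \<le> L0 g x)"
    by (rule theI[where P = "\<lambda>x. \<forall>y. L0 g y \<le> L0 g x" and a = x])
       (use x L0_maximizer_unique in metis)+
  then show ?thesis by (simp add: lambda_star_def)
qed

section \<open>The optimality condition\<close>

text \<open>With \<open>m = max 1 \<bar>t\<^sub>1\<bar> \<bar>t\<^sub>2\<bar>\<close>, either \<open>m \<le> 1 / e\<close> or \<open>m\<^sup>3 \<le> e m\<^sup>4\<close>.\<close>

lemma low_monom2_bound:
  assumes "mdeg j \<le> 3" "e > 0"
  shows "\<bar>monom2 j t\<bar> \<le> e * wt t + (1 / e) ^ 3"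
proof -
  define m where "m = max 1 (max \<bar>fst t\<bar> \<bar>snd t\<bar>)"
  have m: "\<bar>monom2 j t\<bar> \<le> m ^ mdeg j" "m ^ 4 \<le> wt t" "1 \<le> m"
    unfolding m_def by (rule abs_monom2_le_max)+
  have "m ^ mdeg j \<le> m ^ 3" by (intro power_increasing assms m)
  moreover have "m ^ 3 \<le> e * m ^ 4 + (1 / e) ^ 3"
  proof (cases "m \<le> 1 / e")
    case True
    then have "m ^ 3 \<le> (1 / e) ^ 3" using m(3) by (intro power_mono) auto
    moreover have "0 \<le> e * m ^ 4" using assms(2) m(3) by simp
    ultimately show ?thesis by linarith
  next
    case False
    then have "1 \<le> e * m" using assms(2) by (simp add: field_simps)
    then have "1 * m ^ 3 \<le> (e * m) * m ^ 3" using m(3) by (intro mult_right_mono) auto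
    moreover have "0 \<le> (1 / e) ^ 3" using assms(2) by simp
    moreover have "(e * m) * m ^ 3 = e * m ^ 4" by (simp add: power_numeral_reduce)
    ultimately show ?thesis by linarith
  qed
  moreover have "e * m ^ 4 \<le> e * wt t" using m(2) assms(2) by simp
  ultimately show ?thesis using m(1) by linarith
qed

text \<open>By homogeneity a quartic form that is negative on the compact set
  \<open>t\<^sub>1\<^sup>4 + t\<^sub>2\<^sup>4 = 1\<close> is at most a negative multiple of \<open>t\<^sub>1\<^sup>4 + t\<^sub>2\<^sup>4\<close>, which dominates the lower-order
  terms.\<close>

lemma neg_leading_form_decaying:
  assumes neg: "\<And>t. t \<noteq> 0 \<Longrightarrow> (\<Sum>i | mdeg (mi i) = 4. x $ i * monom2 (mi i) t) < 0"
  shows "x \<in> decaying"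
proof -
  define Q where "Q t = (\<Sum>i | mdeg (mi i) = 4. x $ i * monom2 (mi i) t)" for t
  define P where "P t = fst t ^ 4 + snd t ^ 4" for t :: "real \<times> real"
  have wtP: "wt t = 1 + P t" for t by (simp add: wt_def P_def)
  have P_hom: "P (s *\<^sub>R t) = s ^ 4 * P t" for s t
    by (simp add: P_def power_mult_distrib algebra_simps)
  have Q_hom: "Q (s *\<^sub>R t) = s ^ 4 * Q t" for s t
  proof -
    have "monom2 (mi i) (s *\<^sub>R t) = s ^ 4 * monom2 (mi i) t" if "mdeg (mi i) = 4" for i
      using that by (simp add: monom2_def mdeg_def power_mult_distrib mult_ac power_add[symmetric])
    then show ?thesis
      by (simp add: Q_def sum_distrib_left mult.left_commute)
  qed
  have P_pos: "P t > 0" if "t \<noteq> 0" for t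
  proof -
    have "fst t \<noteq> 0 \<or> snd t \<noteq> 0" using that by (cases t) (auto simp: zero_prod_def)
    then show ?thesis by (auto simp: P_def add_pos_nonneg add_nonneg_pos)
  qed
  have bdd: "bounded {t. P t = 1}"
  proof -
    have "\<bar>fst t\<bar> \<le> 1 \<and> \<bar>snd t\<bar> \<le> 1" if "P t = 1" for t
    proof -
      have nonneg: "0 \<le> fst t ^ 4" "0 \<le> snd t ^ 4" by simp_all
      have "\<bar>fst t\<bar> ^ 4 \<le> 1 ^ 4" "\<bar>snd t\<bar> ^ 4 \<le> 1 ^ 4"
        using that nonneg
        unfolding P_def by (simp_all only: power_even_abs power_one even_numeral)
      then show ?thesis by (subst (asm) (1 2) power_mono_iff) auto
    qed
    then have "{t. P t = 1} \<subseteq> {-1..1} \<times> {-1..1}" by (force simp: abs_le_iff)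
    then show ?thesis
      by (rule bounded_subset[rotated]) (intro bounded_Times bounded_closed_interval)
  qed
  have "closed {t. P t = 1}"
    unfolding P_def by (intro closed_Collect_eq continuous_intros)
  then have "compact {t. P t = 1}" using bdd by (simp add: compact_eq_bounded_closed)
  moreover have "(1, 0) \<in> {t. P t = 1}" by (simp add: P_def)
  moreover have "continuous_on {t. P t = 1} Q"
    unfolding Q_def by (intro continuous_intros)
  ultimately obtain t0 where t0: "P t0 = 1" "\<And>t. P t = 1 \<Longrightarrow> Q t \<le> Q t0"
    using continuous_attains_sup[of "{t. P t = 1}" Q] by blast
  \<comment> \<open>\<open>- c\<close> is the maximum of the leading form on the compact set.\<close>
  define c where "c = - Q t0"
  have "t0 \<noteq> 0" using t0(1) by (auto simp: P_def)
  then have c: "c > 0" using neg[of t0] by (simp add: c_def Q_def)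
  have Q: "Q t \<le> - c * P t" for t
  proof (cases "t = 0")
    case True
    have "P 0 = 0" by (simp add: P_def)
    moreover have "Q 0 = 0" using Q_hom[of 0 0] by simp
    ultimately show ?thesis using True by simp
  next
    case False
    define s where "s = root 4 (P t)"
    have s: "s > 0" "s ^ 4 = P t" using P_pos[OF False] by (simp_all add: s_def)
    have "P ((1 / s) *\<^sub>R t) = 1" using s P_pos[OF False] by (simp add: P_hom power_divide)
    then have "Q ((1 / s) *\<^sub>R t) \<le> - c" using t0(2) by (simp add: c_def)
    then have "Q t / s ^ 4 \<le> - c" by (simp add: Q_hom power_divide)
    then have "Q t \<le> - c * s ^ 4" using s(1) by (simp add: pos_divide_le_eq)
    then show ?thesis using s(2) by simp
  qed
  let ?L = "{i. mdeg (mi i) \<noteq> 4}"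
  define M where "M = (\<Sum>i\<in>?L. \<bar>x $ i\<bar>) + 1"
  have M: "M > 0" unfolding M_def by (simp add: add_nonneg_pos sum_nonneg)
  \<comment> \<open>With this \<open>e\<close> the lower-order terms use up half of the decay of the leading form.\<close>
  define e where "e = c / (2 * M)"
  have e: "e > 0" using c M by (simp add: e_def)
  define D where "D = M * (1 / e) ^ 3"
  have "pol x t \<le> (c + D) - (c / 2) * wt t" for t
  proof -
    have "pol x t = Q t + (\<Sum>i\<in>?L. x $ i * monom2 (mi i) t)"
      unfolding pol_def Q_def
      by (subst sum.union_disjoint[symmetric]) (auto intro!: sum.cong)
    also have "(\<Sum>i\<in>?L. x $ i * monom2 (mi i) t) \<le> (\<Sum>i\<in>?L. \<bar>x $ i\<bar> * (e * wt t + (1 / e) ^ 3))"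
    proof (rule sum_mono)
      fix i assume "i \<in> ?L"
      then have "mdeg (mi i) \<le> 3" using mdeg_mi[of i] by auto
      then have "\<bar>x $ i\<bar> * \<bar>monom2 (mi i) t\<bar> \<le> \<bar>x $ i\<bar> * (e * wt t + (1 / e) ^ 3)"
        using e by (intro mult_left_mono low_monom2_bound) auto
      then show "x $ i * monom2 (mi i) t \<le> \<bar>x $ i\<bar> * (e * wt t + (1 / e) ^ 3)"
        using abs_ge_self[of "x $ i * monom2 (mi i) t"] by (simp add: abs_mult)
    qed
    also have "\<dots> \<le> M * (e * wt t + (1 / e) ^ 3)"
      unfolding sum_distrib_right[symmetric] using e wt_ge_1[of t]
      by (intro mult_right_mono) (auto simp: M_def)
    also have "\<dots> = c / 2 * wt t + D" using M by (simp add: D_def e_def algebra_simps)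
    finally show ?thesis using Q[of t] by (simp add: wtP field_simps)
  qed
  then show ?thesis unfolding decaying_def using c
    by (intro CollectI exI[of _ "c / 2"] conjI exI[of _ "c + D"]) auto
qed

text \<open>On the open set \<open>decaying\<close> the gradient of \<open>L0 g\<close> is \<open>g - momvec\<close>, and it vanishes at the maximizer.\<close>

lemma momvec_lambda_star:
  assumes "g \<in> G_set"
  shows "lambda_star g \<in> decaying" and "momvec (lambda_star g) = g"
proof -
  let ?x = "lambda_star g"
  show x: "?x \<in> decaying"
    using assms by (intro neg_leading_form_decaying) (auto simp: G_set_def)
  define D where "D h = g \<bullet> h - (\<Sum>k\<in>UNIV. h $ k * mom ?x ((0, 0) + mi k))" for h
  have der: "((\<lambda>y. g \<bullet> y - mom y (0, 0)) has_derivative D) (at ?x)"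
    unfolding D_def by (intro derivative_intros has_derivative_mom x)
  have "D = (\<lambda>h. 0)"
  proof (rule differential_zero_maxmin[OF x open_decaying der])
    have "g \<bullet> y - mom y (0, 0) \<le> g \<bullet> ?x - mom ?x (0, 0)" if "y \<in> decaying" for y
      using lambda_star_maximizes[of g y] assms L0_decaying[OF that] L0_decaying[OF x] by (simp add: G_set_def)
    then show "(\<forall>y\<in>decaying. g \<bullet> y - mom y (0, 0) \<le> g \<bullet> ?x - mom ?x (0, 0)) \<or>
        (\<forall>y\<in>decaying. g \<bullet> ?x - mom ?x (0, 0) \<le> g \<bullet> y - mom y (0, 0))"
      by blast
  qed
  moreover have "D h = (g - momvec ?x) \<bullet> h" for h
    by (simp add: D_def momvec_def inner_vec_def zero_prod_def[symmetric] left_diff_distrib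
        sum_subtractf mult.commute[of "h $ _"])
  ultimately have "(g - momvec ?x) \<bullet> (g - momvec ?x) = 0" by metis
  then show "momvec ?x = g" by simp
qed

section \<open>Integration by parts\<close>

lemma integral_derivative_eq_0:
  fixes F f :: "real \<Rightarrow> real"
  assumes der: "\<And>u. (F has_real_derivative f u) (at u)"
    and cont: "continuous_on UNIV f" and int: "integrable lborel f"
    and bot: "(F \<longlongrightarrow> 0) at_bot" and top: "(F \<longlongrightarrow> 0) at_top"
  shows "(LINT u|lborel. f u) = 0"
proof -
  have "(LBINT u=-\<infinity>..\<infinity>. f u) = 0 - 0"
  proof (rule interval_integral_FTC_integrable)
    show "(F has_vector_derivative f u) (at u)" for u
      using der by (simp add: has_real_derivative_iff_has_vector_derivative)
    show "isCont f u" for u using cont by (simp add: continuous_on_eq_continuous_at)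
    show "set_integrable lborel (einterval (- \<infinity>) \<infinity>) f"
      using int by (simp add: set_integrable_def)
  qed (use bot top in \<open>simp_all add: ereal_tendsto_simps\<close>)
  then show ?thesis
    by (simp add: interval_lebesgue_integral_def set_lebesgue_integral_def)
qed

lemma tendsto_0_of_le_wt:
  fixes F :: "real \<Rightarrow> real"
  assumes "\<And>u. \<bar>F u\<bar> \<le> K / (1 + u ^ 4 + b)" and "b \<ge> 0"
  shows "(F \<longlongrightarrow> 0) at_bot" and "(F \<longlongrightarrow> 0) at_top"
proof -
  have pow: "filterlim (\<lambda>u :: real. 1 + u ^ 4 + b) at_top F" if "filterlim (\<lambda>u. \<bar>u\<bar>) at_top F" for F
  proof (rule filterlim_at_top_mono)
    show "filterlim (\<lambda>u. \<bar>u\<bar>) at_top F" by (rule that)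
    have "\<bar>u\<bar> \<le> 1 + u ^ 4 + b" for u
    proof (cases "\<bar>u\<bar> \<le> 1")
      case True
      moreover have "0 \<le> u ^ 4" by simp
      ultimately show ?thesis using assms(2) by linarith
    next
      case False
      then have "\<bar>u\<bar> ^ 1 \<le> \<bar>u\<bar> ^ 4" by (intro power_increasing) auto
      then have "\<bar>u\<bar> \<le> u ^ 4" by simp
      then show ?thesis using assms(2) by linarith
    qed
    then show "\<forall>\<^sub>F u in F. \<bar>u\<bar> \<le> 1 + u ^ 4 + b" by simp
  qed
  have lim: "(F \<longlongrightarrow> 0) G" if "filterlim (\<lambda>u :: real. \<bar>u\<bar>) at_top G" for G
  proof (rule tendsto_rabs_zero_cancel, rule tendsto_sandwich[of "\<lambda>_. 0"])
    show "((\<lambda>u. K / (1 + u ^ 4 + b)) \<longlongrightarrow> 0) G"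
      by (intro real_tendsto_divide_at_top[OF tendsto_const] pow that)
  qed (use assms in auto)
  have "filterlim (\<lambda>u :: real. \<bar>u\<bar>) at_top at_bot"
    by (rule filterlim_at_top_mono[OF filterlim_uminus_at_top_at_bot]) (auto intro: always_eventually)
  then show "(F \<longlongrightarrow> 0) at_bot" by (rule lim)
  show "(F \<longlongrightarrow> 0) at_top" by (rule lim[OF filterlim_abs_real])
qed

text \<open>Fubini's theorem, integrating first in the variable of differentiation. The bound makes \<open>F\<close> vanish at
  both ends of every line.\<close>

lemma partial_derivative_integral_eq_0:
  fixes F D :: "real \<times> real \<Rightarrow> real"
  assumes int: "integrable lborel D" and cont: "continuous_on UNIV D"
    and bound: "\<And>t. \<bar>F t\<bar> \<le> K / wt t"
  shows "(\<And>u v. ((\<lambda>u. F (u, v)) has_real_derivative D (u, v)) (at u)) \<Longrightarrow> (LINT t|lborel. D t) = 0"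
    and "(\<And>u v. ((\<lambda>v. F (u, v)) has_real_derivative D (u, v)) (at v)) \<Longrightarrow> (LINT t|lborel. D t) = 0"
proof -
  have int2: "integrable (lborel \<Otimes>\<^sub>M lborel) (case_prod (\<lambda>u v. D (u, v)))"
    using int by (simp add: lborel_prod)
  have cu: "continuous_on UNIV (\<lambda>u. D (u, v))" for v
    by (intro continuous_on_compose2[OF cont] continuous_intros) auto
  have cv: "continuous_on UNIV (\<lambda>v. D (u, v))" for u
    by (intro continuous_on_compose2[OF cont] continuous_intros) auto
  have fubini: "(LINT t|lborel. D t) = (LINT t|(lborel \<Otimes>\<^sub>M lborel). case_prod (\<lambda>u v. D (u, v)) t)"
    by (simp add: lborel_prod)
  {
    assume der: "\<And>u v. ((\<lambda>u. F (u, v)) has_real_derivative D (u, v)) (at u)"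
    have "(LINT u|lborel. D (u, v)) = 0" if "integrable lborel (\<lambda>u. D (u, v))" for v
    proof (rule integral_derivative_eq_0[OF der cu that])
      have "\<bar>F (u, v)\<bar> \<le> K / (1 + u ^ 4 + v ^ 4)" for u
        using bound[of "(u, v)"] by (simp add: wt_def)
      from tendsto_0_of_le_wt[OF this]
      show "((\<lambda>u. F (u, v)) \<longlongrightarrow> 0) at_bot" "((\<lambda>u. F (u, v)) \<longlongrightarrow> 0) at_top"
        by simp_all
    qed
    then have "AE v in lborel. (LINT u|lborel. D (u, v)) = 0"
      using lborel_pair.AE_integrable_snd[OF int2] by (auto elim: eventually_mono)
    then have "(LINT v|lborel. LINT u|lborel. D (u, v)) = 0"
      by (rule integral_eq_zero_AE)
    then show "(LINT t|lborel. D t) = 0"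
      unfolding fubini using lborel_pair.integral_snd[OF int2] by simp
  }
  {
    assume der: "\<And>u v. ((\<lambda>v. F (u, v)) has_real_derivative D (u, v)) (at v)"
    have "(LINT v|lborel. D (u, v)) = 0" if "integrable lborel (\<lambda>v. D (u, v))" for u
    proof (rule integral_derivative_eq_0[OF der cv that])
      have "\<bar>F (u, v)\<bar> \<le> K / (1 + v ^ 4 + u ^ 4)" for v
        using bound[of "(u, v)"] by (simp add: wt_def ac_simps)
      from tendsto_0_of_le_wt[OF this]
      show "((\<lambda>v. F (u, v)) \<longlongrightarrow> 0) at_bot" "((\<lambda>v. F (u, v)) \<longlongrightarrow> 0) at_top"
        by simp_all
    qed
    then have "AE u in lborel. (LINT v|lborel. D (u, v)) = 0"
      using lborel_pair.AE_integrable_fst[OF int2] by (auto elim: eventually_mono)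
    then have "(LINT u|lborel. LINT v|lborel. D (u, v)) = 0"
      by (rule integral_eq_zero_AE)
    then show "(LINT t|lborel. D t) = 0"
      unfolding fubini using lborel_pair.integral_fst[OF int2] by simp
  }
qed

lemma sum_shift_fst:
  fixes f :: "nat \<times> nat \<Rightarrow> real"
  assumes "\<And>b. f (0, b) = 0"
  shows "(\<Sum>i | mdeg i \<le> Suc n. f i) = (\<Sum>\<kappa> | mdeg \<kappa> \<le> n. f (\<kappa> + (1, 0)))"
proof -
  have "(\<Sum>i | mdeg i \<le> Suc n. f i) = (\<Sum>i\<in>{i. mdeg i \<le> Suc n \<and> fst i \<noteq> 0}. f i)"
    by (intro sum.mono_neutral_right finite_mdeg_le) (auto, metis assms gr0I)
  also have "\<dots> = (\<Sum>\<kappa> | mdeg \<kappa> \<le> n. f (\<kappa> + (1, 0)))"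
    by (rule sum.reindex_bij_witness[of _ "\<lambda>\<kappa>. \<kappa> + (1, 0)" "\<lambda>i. i - (1, 0)"]) (auto simp: mdeg_def)
  finally show ?thesis .
qed

lemma sum_shift_snd:
  fixes f :: "nat \<times> nat \<Rightarrow> real"
  assumes "\<And>a. f (a, 0) = 0"
  shows "(\<Sum>i | mdeg i \<le> Suc n. f i) = (\<Sum>\<kappa> | mdeg \<kappa> \<le> n. f (\<kappa> + (0, 1)))"
proof -
  have "(\<Sum>i | mdeg i \<le> Suc n. f i) = (\<Sum>i\<in>{i. mdeg i \<le> Suc n \<and> snd i \<noteq> 0}. f i)"
    by (intro sum.mono_neutral_right finite_mdeg_le) (auto, metis assms gr0I)
  also have "\<dots> = (\<Sum>\<kappa> | mdeg \<kappa> \<le> n. f (\<kappa> + (0, 1)))"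
    by (rule sum.reindex_bij_witness[of _ "\<lambda>\<kappa>. \<kappa> + (0, 1)" "\<lambda>i. i - (0, 1)"]) (auto simp: mdeg_def)
  finally show ?thesis .
qed

lemma has_derivative_monom2_fst:
  "((\<lambda>u. monom2 i (u, v)) has_real_derivative real (fst i) * monom2 (i - (1, 0)) (u, v)) (at u)"
  by (auto simp: monom2_def intro!: derivative_eq_intros)

lemma has_derivative_monom2_snd:
  "((\<lambda>v. monom2 i (u, v)) has_real_derivative real (snd i) * monom2 (i - (0, 1)) (u, v)) (at v)"
  by (auto simp: monom2_def intro!: derivative_eq_intros)

text \<open>The partial derivatives of \<open>pol x\<close>, indexed by the exponent that remains after differentiation,
  as in the definition of \<open>c_co\<close>.\<close>

definition pol_deriv_fst :: "real ^ idx4 \<Rightarrow> real \<times> real \<Rightarrow> real" where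
  "pol_deriv_fst x t = (\<Sum>\<kappa> | mdeg \<kappa> \<le> 3. real (fst \<kappa> + 1) * x $ Idx (\<kappa> + (1, 0)) * monom2 \<kappa> t)"

definition pol_deriv_snd :: "real ^ idx4 \<Rightarrow> real \<times> real \<Rightarrow> real" where
  "pol_deriv_snd x t = (\<Sum>\<kappa> | mdeg \<kappa> \<le> 3. real (snd \<kappa> + 1) * x $ Idx (\<kappa> + (0, 1)) * monom2 \<kappa> t)"

lemma has_derivative_pol_fst:
  "((\<lambda>u. pol x (u, v)) has_real_derivative pol_deriv_fst x (u, v)) (at u)"
proof -
  have four: "(4 :: nat) = Suc 3" by simp
  have "((\<lambda>u. pol x (u, v)) has_real_derivative
      (\<Sum>i | mdeg i \<le> Suc 3. x $ Idx i * (real (fst i) * monom2 (i - (1, 0)) (u, v)))) (at u)"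
    unfolding pol_sum four by (intro DERIV_sum DERIV_cmult has_derivative_monom2_fst)
  also have "(\<Sum>i | mdeg i \<le> Suc 3. x $ Idx i * (real (fst i) * monom2 (i - (1, 0)) (u, v))) = pol_deriv_fst x (u, v)"
    by (subst sum_shift_fst) (auto simp: pol_deriv_fst_def mult_ac intro!: sum.cong)
  finally show ?thesis .
qed

lemma has_derivative_pol_snd:
  "((\<lambda>v. pol x (u, v)) has_real_derivative pol_deriv_snd x (u, v)) (at v)"
proof -
  have four: "(4 :: nat) = Suc 3" by simp
  have "((\<lambda>v. pol x (u, v)) has_real_derivative
      (\<Sum>i | mdeg i \<le> Suc 3. x $ Idx i * (real (snd i) * monom2 (i - (0, 1)) (u, v)))) (at v)"
    unfolding pol_sum four by (intro DERIV_sum DERIV_cmult has_derivative_monom2_snd)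
  also have "(\<Sum>i | mdeg i \<le> Suc 3. x $ Idx i * (real (snd i) * monom2 (i - (0, 1)) (u, v))) = pol_deriv_snd x (u, v)"
    by (subst sum_shift_snd) (auto simp: pol_deriv_snd_def mult_ac intro!: sum.cong)
  finally show ?thesis .
qed

text \<open>The integral of \<open>\<partial>\<^sub>1 (t\<^sup>m e\<^sup>p)\<close> is zero. If \<open>m\<^sub>1 = 0\<close>, the truncated index \<open>m - (1, 0)\<close> occurs with
  the factor 0.\<close>

lemma integration_by_parts_fst:
  assumes x: "x \<in> decaying"
  shows "real (fst m) * mom x (m - (1, 0))
    + (\<Sum>\<kappa> | mdeg \<kappa> \<le> 3. real (fst \<kappa> + 1) * x $ Idx (\<kappa> + (1, 0)) * mom x (m + \<kappa>)) = 0"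
proof -
  define D where "D t = (real (fst m) * monom2 (m - (1, 0)) t + monom2 m t * pol_deriv_fst x t) * exp (pol x t)" for t
  have D: "D t = real (fst m) * (monom2 (m - (1, 0)) t * exp (pol x t))
    + (\<Sum>\<kappa> | mdeg \<kappa> \<le> 3. real (fst \<kappa> + 1) * x $ Idx (\<kappa> + (1, 0)) * (monom2 (m + \<kappa>) t * exp (pol x t)))" for t
    by (simp add: D_def pol_deriv_fst_def monom2_add ring_distribs sum_distrib_left sum_distrib_right mult_ac)
  note ints = monom2_exp_pol_bound(1)[OF x]
  obtain K where K: "\<And>t. \<bar>monom2 m t * exp (pol x t)\<bar> \<le> K / wt t"
    using monom2_exp_pol_bound(2)[OF x] by blast
  have intD: "integrable lborel D"
    unfolding D by (intro Bochner_Integration.integrable_add Bochner_Integration.integrable_sum integrable_mult_right ints)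
  have "(LINT t|lborel. D t) = 0"
  proof (rule partial_derivative_integral_eq_0(1)[OF intD _ K])
    show "continuous_on UNIV D"
      unfolding D_def pol_deriv_fst_def by (intro continuous_intros)
    show "((\<lambda>u. monom2 m (u, v) * exp (pol x (u, v))) has_real_derivative D (u, v)) (at u)" for u v
      by (auto intro!: derivative_eq_intros has_derivative_monom2_fst has_derivative_pol_fst
          simp: D_def algebra_simps)
  qed
  then show ?thesis
    unfolding D by (simp add: ints mom_def)
qed

lemma integration_by_parts_snd:
  assumes x: "x \<in> decaying"
  shows "real (snd m) * mom x (m - (0, 1))
    + (\<Sum>\<kappa> | mdeg \<kappa> \<le> 3. real (snd \<kappa> + 1) * x $ Idx (\<kappa> + (0, 1)) * mom x (m + \<kappa>)) = 0"
proof -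
  define D where "D t = (real (snd m) * monom2 (m - (0, 1)) t + monom2 m t * pol_deriv_snd x t) * exp (pol x t)" for t
  have D: "D t = real (snd m) * (monom2 (m - (0, 1)) t * exp (pol x t))
    + (\<Sum>\<kappa> | mdeg \<kappa> \<le> 3. real (snd \<kappa> + 1) * x $ Idx (\<kappa> + (0, 1)) * (monom2 (m + \<kappa>) t * exp (pol x t)))" for t
    by (simp add: D_def pol_deriv_snd_def monom2_add ring_distribs sum_distrib_left sum_distrib_right mult_ac)
  note ints = monom2_exp_pol_bound(1)[OF x]
  obtain K where K: "\<And>t. \<bar>monom2 m t * exp (pol x t)\<bar> \<le> K / wt t"
    using monom2_exp_pol_bound(2)[OF x] by blast
  have intD: "integrable lborel D"
    unfolding D by (intro Bochner_Integration.integrable_add Bochner_Integration.integrable_sum integrable_mult_right ints)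
  have "(LINT t|lborel. D t) = 0"
  proof (rule partial_derivative_integral_eq_0(2)[OF intD _ K])
    show "continuous_on UNIV D"
      unfolding D_def pol_deriv_snd_def by (intro continuous_intros)
    show "((\<lambda>v. monom2 m (u, v) * exp (pol x (u, v))) has_real_derivative D (u, v)) (at v)" for u v
      by (auto intro!: derivative_eq_intros has_derivative_monom2_snd has_derivative_pol_snd
          simp: D_def algebra_simps)
  qed
  then show ?thesis
    unfolding D by (simp add: ints mom_def)
qed

section \<open>Reduction of moments of higher order\<close>

lemma exhaust_6: "i = 1 \<or> i = 2 \<or> i = 3 \<or> i = 4 \<or> i = 5 \<or> i = 6" for i :: 6
proof (induct i)
  case (of_int z)
  then have "z = 0 \<or> z = 1 \<or> z = 2 \<or> z = 3 \<or> z = 4 \<or> z = 5" by fastforce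
  then show ?case by auto
qed

lemma UNIV_6: "UNIV = {1, 2, 3, 4, 5, 6 :: 6}"
  using exhaust_6 by auto

lemma sum_6: "sum f (UNIV :: 6 set) = f 1 + f 2 + f 3 + f 4 + f 5 + f 6"
  unfolding UNIV_6 by (simp add: ac_simps)

lemma vector_6:
  "(vector [a, b, c, d, e, f] :: 'a :: zero ^ 6) $ 1 = a"
  "(vector [a, b, c, d, e, f] :: 'a ^ 6) $ 2 = b"
  "(vector [a, b, c, d, e, f] :: 'a ^ 6) $ 3 = c"
  "(vector [a, b, c, d, e, f] :: 'a ^ 6) $ 4 = d"
  "(vector [a, b, c, d, e, f] :: 'a ^ 6) $ 5 = e"
  "(vector [a, b, c, d, e, f] :: 'a ^ 6) $ 6 = f"
  unfolding vector_def by simp_all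

lemma matrix_mult_matrix_inv: "invertible A \<Longrightarrow> A ** matrix_inv A = mat 1"
  unfolding invertible_def matrix_inv_def by (metis (mono_tags, lifting) someI_ex)

lemma A_mat_sol_vec:
  assumes "r_defined x"
  shows "A_mat x *v sol_vec x j = rhs_vec x j"
proof -
  have "invertible (A_mat x)"
    using assms by (simp add: r_defined_def invertible_det_nz)
  then show ?thesis
    by (simp add: sol_vec_def matrix_vector_mul_assoc matrix_mult_matrix_inv)
qed

text \<open>Only the last three terms of the sum that defines \<open>\<beta>\<^sub>q\<close> contribute: for \<open>p = q - 4\<close> the factor
  \<open>4 + p - q\<close> is zero, and for smaller \<open>p\<close> the index \<open>4 + p - q\<close> is negative and the coordinate is zero by convention.\<close>

lemma beta_low_recursion:
  assumes x: "co x 4 0 \<noteq> 0" and q: "q \<le> ell j - 5" "0 \<le> q"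
  shows "4 * co x 4 0 * beta_low x j q + 3 * co x 3 1 * beta_low x j (q - 1)
    + 2 * co x 2 2 * beta_low x j (q - 2) + co x 1 3 * beta_low x j (q - 3) = delta j q"
proof -
  obtain n where n: "q = int n" using q(2) nonneg_int_cases by blast
  define f where "f p = real_of_int (4 + int p - int n) * coZ x (4 + int p - int n) (int n - int p) * beta_rec x j p" for p
  have low: "beta_low x j (int p) = beta_rec x j p" if "p \<le> n" for p
    using that q by (simp add: beta_low_def n)
  have neg: "beta_low x j p = 0" if "p < 0" for p using that by (simp add: beta_low_def)
  have "4 * co x 4 0 * beta_rec x j n = - (\<Sum>p<n. f p) + delta j q"
    using x by (simp add: beta_rec.simps[of x j n] f_def n)
  moreover have "(\<Sum>p<n. f p) = 3 * co x 3 1 * beta_low x j (q - 1)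
    + 2 * co x 2 2 * beta_low x j (q - 2) + co x 1 3 * beta_low x j (q - 3)"
  proof -
    have "(\<Sum>p<n. f p) = (\<Sum>p\<in>{n-3..<n}. f p)"
    proof (intro sum.mono_neutral_right ballI)
      fix p assume "p \<in> {..<n} - {n-3..<n}"
      then have "4 + int p - int n \<le> 0" by auto
      then show "f p = 0" by (cases "4 + int p - int n = 0") (auto simp: f_def coZ_def)
    qed auto
    also have "\<dots> = 3 * co x 3 1 * beta_low x j (q - 1)
      + 2 * co x 2 2 * beta_low x j (q - 2) + co x 1 3 * beta_low x j (q - 3)"
    proof -
      consider "n = 0" | "n = 1" | "n = 2" | k where "n = k + 3"
        by (metis One_nat_def add.commute less_2_cases_iff le_add_diff_inverse2 less_Suc_eq not_less numeral_2_eq_2 numeral_3_eq_3)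
      then show ?thesis
      proof cases
        case 4
        have set: "{n-3..<n} = {k, k + 1, k + 2}" using 4 by auto
        have "beta_low x j (q - 1) = beta_rec x j (k + 2)" "beta_low x j (q - 2) = beta_rec x j (k + 1)"
            "beta_low x j (q - 3) = beta_rec x j k"
          using low[of "k + 2"] low[of "k + 1"] low[of k] 4 by (simp_all add: n algebra_simps)
        then show ?thesis
          unfolding set by (simp add: f_def coZ_def 4)
      next
        case 1 then show ?thesis by (simp add: n neg)
      next
        case 2
        then have set: "{n-3..<n} = {0}" by auto
        show ?thesis unfolding set using low[of 0] 2 by (simp add: f_def n neg coZ_def)
      next
        case 3
        then have set: "{n-3..<n} = {0, 1}" by auto
        show ?thesis unfolding set using low[of 0] low[of 1] 3 by (simp add: f_def n neg coZ_def)
      qed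
    qed
    finally show ?thesis .
  qed
  ultimately show ?thesis using low[of n] by (simp add: n)
qed

text \<open>With \<open>P\<close> the leading form of \<open>pol x\<close>, this compares the coefficients of the monomial of degree \<open>|j|\<close>
  and exponent \<open>q\<close> in \<open>t\<^sub>2\<close> in the equation \<open>b \<partial>\<^sub>1P - a \<partial>\<^sub>2P = t\<^sup>j\<close>. For \<open>q \<le> |j| - 6\<close> it is the recursion for
  \<open>\<beta>\<close>, and for the last six values of \<open>q\<close> a row of the linear system.\<close>

lemma leading_coefficient_eq:
  assumes x: "r_defined x" and j: "mdeg j \<ge> 5" and q: "0 \<le> q" "q \<le> ell j + 1"
  shows "4 * co x 4 0 * beta x j q + 3 * co x 3 1 * beta x j (q - 1)
      + 2 * co x 2 2 * beta x j (q - 2) + co x 1 3 * beta x j (q - 3)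
    - (co x 3 1 * alpha x j q + 2 * co x 2 2 * alpha x j (q - 1)
      + 3 * co x 1 3 * alpha x j (q - 2) + 4 * co x 0 4 * alpha x j (q - 3)) = delta j q"
proof -
  have rows: "(A_mat x *v sol_vec x j) $ k = rhs_vec x j $ k" for k
    using A_mat_sol_vec[OF x] by simp
  note row = rows[unfolded matrix_vector_mult_def A_mat_def rhs_vec_def Let_def, simplified sum_6 vec_lambda_beta vector_6]
  consider "q \<le> ell j - 5" | "q = ell j - 4" | "q = ell j - 3" | "q = ell j - 2"
    | "q = ell j - 1" | "q = ell j" | "q = ell j + 1" using q by linarith
  then show ?thesis
  proof cases
    case 1
    then have "alpha x j q = 0" "alpha x j (q - 1) = 0" "alpha x j (q - 2) = 0" "alpha x j (q - 3) = 0"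
      by (simp_all add: alpha_def)
    moreover have "beta x j q = beta_low x j q" "beta x j (q - 1) = beta_low x j (q - 1)"
        "beta x j (q - 2) = beta_low x j (q - 2)" "beta x j (q - 3) = beta_low x j (q - 3)"
      using 1 by (simp_all add: beta_def)
    ultimately show ?thesis
      using beta_low_recursion[of x q j] x 1 q by (simp add: r_defined_def)
  next
    case 2 then show ?thesis using row[of 1] by (simp add: vector_6 alpha_def beta_def)
  next
    case 3 then show ?thesis using row[of 2] by (simp add: vector_6 alpha_def beta_def)
  next
    case 4 then show ?thesis using row[of 3] by (simp add: vector_6 alpha_def beta_def)
  next
    case 5 then show ?thesis using row[of 4] by (simp add: vector_6 alpha_def beta_def beta_low_def)
  next
    case 6 then show ?thesis using row[of 5] by (simp add: vector_6 alpha_def beta_def beta_low_def)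
  next
    case 7 then show ?thesis using row[of 6] by (simp add: vector_6 alpha_def beta_def beta_low_def)
  qed
qed

lemma alpha_outside: "q < ell j - 4 \<or> ell j - 2 < q \<Longrightarrow> alpha x j q = 0"
  by (auto simp: alpha_def)

lemma beta_outside:
  assumes "mdeg j \<ge> 5" "q < 0 \<or> ell j - 2 < q"
  shows "beta x j q = 0"
  using assms by (auto simp: beta_def beta_low_def ell_def)

lemma finite_I_set: "finite (I_set j k)"
  by (rule finite_subset[OF _ finite_mdeg_le[of "mdeg k"]])
     (auto simp: I_set_def mdeg_def less_eq_prod_def)

text \<open>Collects the terms with the same \<open>k = m + \<kappa>\<close>; the set \<open>I_set j k\<close> consists of those \<open>\<kappa> \<le> k\<close> for which
  \<open>k - \<kappa>\<close> has degree \<open>|j| - 3\<close>.\<close>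

lemma sum_over_I_set:
  fixes h :: "nat \<times> nat \<Rightarrow> nat \<times> nat \<Rightarrow> real"
  assumes "mdeg j = L + 3"
  shows "(\<Sum>m | mdeg m = L. \<Sum>\<kappa> | mdeg \<kappa> \<le> 3. h \<kappa> m * M (m + \<kappa>))
       = (\<Sum>k | mdeg k \<le> mdeg j. (\<Sum>\<kappa>\<in>I_set j k. h \<kappa> (k - \<kappa>)) * M k)"
proof -
  have fin: "finite {m. mdeg m = L}"
    by (rule finite_subset[OF _ finite_mdeg_le[of L]]) auto
  have "(\<Sum>m | mdeg m = L. \<Sum>\<kappa> | mdeg \<kappa> \<le> 3. h \<kappa> m * M (m + \<kappa>))
      = (\<Sum>(m, \<kappa>)\<in>(SIGMA m:{m. mdeg m = L}. {\<kappa>. mdeg \<kappa> \<le> 3}). h \<kappa> m * M (m + \<kappa>))"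
    using fin finite_mdeg_le by (subst sum.Sigma) auto
  also have "\<dots> = (\<Sum>(k, \<kappa>)\<in>(SIGMA k:{k. mdeg k \<le> mdeg j}. I_set j k). h \<kappa> (k - \<kappa>) * M k)"
    by (rule sum.reindex_bij_witness[of _ "\<lambda>(k, \<kappa>). (k - \<kappa>, \<kappa>)" "\<lambda>(m, \<kappa>). (m + \<kappa>, \<kappa>)"])
       (use assms in \<open>auto simp: I_set_def mdeg_def ell_def less_eq_prod_def\<close>)
  also have "\<dots> = (\<Sum>k | mdeg k \<le> mdeg j. \<Sum>\<kappa>\<in>I_set j k. h \<kappa> (k - \<kappa>) * M k)"
    using finite_I_set finite_mdeg_le by (subst sum.Sigma) auto
  finally show ?thesis by (simp add: sum_distrib_right)
qed

text \<open>The index \<open>\<kappa>\<close> runs over the four exponents of degree 3. Those that do not satisfy \<open>\<kappa> \<le> k\<close> may be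
  added, since \<open>\<alpha>\<close> and \<open>\<beta>\<close> vanish outside \<open>{0..|j| - 3}\<close>; the sum is then that of
  \<open>leading_coefficient_eq\<close>.\<close>

lemma top_coefficient:
  assumes x: "r_defined x" and j: "mdeg j \<ge> 5" and k: "mdeg k = mdeg j"
  shows "(\<Sum>\<kappa>\<in>I_set j k. real (snd \<kappa> + 1) * x $ Idx (\<kappa> + (0, 1)) * a_co x j (k - \<kappa>)
      - real (fst \<kappa> + 1) * x $ Idx (\<kappa> + (1, 0)) * b_co x j (k - \<kappa>)) = (if k = j then - 1 else 0)"
proof -
  define h where "h \<kappa> = real (snd \<kappa> + 1) * x $ Idx (\<kappa> + (0, 1)) * alpha x j (int (snd k) - int (snd \<kappa>))
      - real (fst \<kappa> + 1) * x $ Idx (\<kappa> + (1, 0)) * beta x j (int (snd k) - int (snd \<kappa>))" for \<kappa>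
  let ?K = "{(3, 0), (2, 1), (1, 2), (0, 3)} :: (nat \<times> nat) set"
  have K: "\<kappa> \<in> ?K \<longleftrightarrow> mdeg \<kappa> = 3" for \<kappa>
  proof
    assume "mdeg \<kappa> = 3"
    moreover obtain a b where ab: "\<kappa> = (a, b)" by force
    ultimately have "a + b = 3" by (simp add: mdeg_def)
    then have "(a = 0 \<and> b = 3) \<or> (a = 1 \<and> b = 2) \<or> (a = 2 \<and> b = 1) \<or> (a = 3 \<and> b = 0)" by arith
    then show "\<kappa> \<in> ?K" using ab by auto
  qed (auto simp: mdeg_def)
  have I: "I_set j k = {\<kappa> \<in> ?K. \<kappa> \<le> k}"
    unfolding I_set_def K using k by (auto simp: ell_def)
  have "(\<Sum>\<kappa>\<in>I_set j k. real (snd \<kappa> + 1) * x $ Idx (\<kappa> + (0, 1)) * a_co x j (k - \<kappa>)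
      - real (fst \<kappa> + 1) * x $ Idx (\<kappa> + (1, 0)) * b_co x j (k - \<kappa>)) = (\<Sum>\<kappa>\<in>I_set j k. h \<kappa>)"
    by (rule sum.cong) (auto simp: h_def a_co_def b_co_def I_set_def less_eq_prod_def of_nat_diff)
  also have "\<dots> = (\<Sum>\<kappa>\<in>?K. h \<kappa>)"
  proof (intro sum.mono_neutral_left ballI)
    fix \<kappa> assume "\<kappa> \<in> ?K - I_set j k"
    then have "mdeg \<kappa> = 3" "\<not> \<kappa> \<le> k" using K[of \<kappa>] I by auto
    then have "int (snd k) - int (snd \<kappa>) < 0 \<or> ell j - 2 < int (snd k) - int (snd \<kappa>)"
      using k by (auto simp: less_eq_prod_def mdeg_def ell_def)
    then show "h \<kappa> = 0"
      using beta_outside[OF j] alpha_outside[of "int (snd k) - int (snd \<kappa>)" j x] j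
      by (auto simp: h_def ell_def)
  qed (auto simp: I)
  also have "\<dots> = - delta j (int (snd k))"
    using leading_coefficient_eq[OF x j, of "int (snd k)"] k
    by (simp add: h_def mdeg_def ell_def algebra_simps eval_nat_numeral)
  also have "\<dots> = (if k = j then - 1 else 0)"
    using k by (auto simp: delta_def ell_def mdeg_def prod_eq_iff)
  finally show ?thesis .
qed

text \<open>The coefficients of \<open>\<partial>\<^sub>2a - \<partial>\<^sub>1b\<close> are the \<open>d_co\<close>.\<close>

lemma sum_d_co_eq_first_order_terms:
  assumes "mdeg j = L + 3" "L \<ge> 2"
  shows "(\<Sum>m | mdeg m = L. a_co x j m * (real (snd m) * M (m - (0, 1))) - b_co x j m * (real (fst m) * M (m - (1, 0))))
       = (\<Sum>k | mdeg k < mdeg j. d_co x j k * M k)"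
proof -
  have fin: "finite {m. mdeg m = n}" for n
    by (rule finite_subset[OF _ finite_mdeg_le[of n]]) auto
  have A: "(\<Sum>m | mdeg m = L. a_co x j m * (real (snd m) * M (m - (0, 1))))
     = (\<Sum>k | mdeg k = L - 1. real (snd k + 1) * a_co x j (k + (0, 1)) * M k)"
  proof -
    have "(\<Sum>m | mdeg m = L. a_co x j m * (real (snd m) * M (m - (0, 1))))
      = (\<Sum>m\<in>{m. mdeg m = L \<and> snd m \<noteq> 0}. a_co x j m * (real (snd m) * M (m - (0, 1))))"
      by (intro sum.mono_neutral_right fin) auto
    also have "\<dots> = (\<Sum>k | mdeg k = L - 1. real (snd k + 1) * a_co x j (k + (0, 1)) * M k)"
      by (rule sum.reindex_bij_witness[of _ "\<lambda>\<kappa>. \<kappa> + (0, 1)" "\<lambda>i. i - (0, 1)"])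
         (use assms(2) in \<open>auto simp: mdeg_def\<close>)
    finally show ?thesis .
  qed
  have B: "(\<Sum>m | mdeg m = L. b_co x j m * (real (fst m) * M (m - (1, 0))))
     = (\<Sum>k | mdeg k = L - 1. real (fst k + 1) * b_co x j (k + (1, 0)) * M k)"
  proof -
    have "(\<Sum>m | mdeg m = L. b_co x j m * (real (fst m) * M (m - (1, 0))))
      = (\<Sum>m\<in>{m. mdeg m = L \<and> fst m \<noteq> 0}. b_co x j m * (real (fst m) * M (m - (1, 0))))"
      by (intro sum.mono_neutral_right fin) auto
    also have "\<dots> = (\<Sum>k | mdeg k = L - 1. real (fst k + 1) * b_co x j (k + (1, 0)) * M k)"
      by (rule sum.reindex_bij_witness[of _ "\<lambda>\<kappa>. \<kappa> + (1, 0)" "\<lambda>i. i - (1, 0)"])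
         (use assms(2) in \<open>auto simp: mdeg_def\<close>)
    finally show ?thesis .
  qed
  have "(\<Sum>k | mdeg k < mdeg j. d_co x j k * M k) = (\<Sum>k | mdeg k = L - 1. d_co x j k * M k)"
    by (intro sum.mono_neutral_right finite_subset[OF _ finite_mdeg_le[of "mdeg j"]])
       (use assms in \<open>auto simp: d_co_def ell_def\<close>)
  also have "\<dots> = (\<Sum>k | mdeg k = L - 1. real (snd k + 1) * a_co x j (k + (0, 1)) * M k
      - real (fst k + 1) * b_co x j (k + (1, 0)) * M k)"
    by (rule sum.cong) (use assms in \<open>auto simp: d_co_def ell_def left_diff_distrib\<close>)
  finally show ?thesis by (simp only: sum_subtractf A B)
qed

text \<open>The identity \<open>\<integral> (\<partial>\<^sub>2 (a e\<^sup>p) - \<partial>\<^sub>1 (b e\<^sup>p)) = 0\<close> for the homogeneous polynomials \<open>a\<close>, \<open>b\<close> with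
  coefficients \<open>a_co\<close>, \<open>b_co\<close>; their choice makes \<open>- t\<^sup>j\<close> the leading form of
  \<open>a \<partial>\<^sub>2p - b \<partial>\<^sub>1p\<close>.\<close>

lemma mom_reduction:
  assumes x: "x \<in> decaying" "r_defined x" and j: "mdeg j \<ge> 5"
  shows "mom x j = (\<Sum>k | mdeg k < mdeg j. c_co x j k * mom x k)"
proof -
  define L where "L = mdeg j - 3"
  have L: "mdeg j = L + 3" "L \<ge> 2" using j by (auto simp: L_def)
  define M where "M = mom x"
  define h where "h \<kappa> m = real (snd \<kappa> + 1) * x $ Idx (\<kappa> + (0, 1)) * a_co x j m
      - real (fst \<kappa> + 1) * x $ Idx (\<kappa> + (1, 0)) * b_co x j m" for \<kappa> m
  have "0 = a_co x j m * (real (snd m) * M (m - (0, 1)) +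
         (\<Sum>\<kappa> | mdeg \<kappa> \<le> 3. real (snd \<kappa> + 1) * x $ Idx (\<kappa> + (0, 1)) * M (m + \<kappa>)))
      - b_co x j m * (real (fst m) * M (m - (1, 0)) +
         (\<Sum>\<kappa> | mdeg \<kappa> \<le> 3. real (fst \<kappa> + 1) * x $ Idx (\<kappa> + (1, 0)) * M (m + \<kappa>)))" for m
    unfolding M_def integration_by_parts_fst[OF x(1)] integration_by_parts_snd[OF x(1)] by simp
  also have "\<dots> m = (a_co x j m * (real (snd m) * M (m - (0, 1))) - b_co x j m * (real (fst m) * M (m - (1, 0))))
      + (\<Sum>\<kappa> | mdeg \<kappa> \<le> 3. h \<kappa> m * M (m + \<kappa>))" for m
    by (simp add: h_def ring_distribs sum_subtractf sum.distrib sum_distrib_left mult_ac)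
  finally have "0 = (\<Sum>m | mdeg m = L. (a_co x j m * (real (snd m) * M (m - (0, 1))) - b_co x j m * (real (fst m) * M (m - (1, 0))))
      + (\<Sum>\<kappa> | mdeg \<kappa> \<le> 3. h \<kappa> m * M (m + \<kappa>)))"
    by (metis (no_types, lifting) sum.neutral)
  also have "\<dots> = (\<Sum>k | mdeg k < mdeg j. d_co x j k * M k)
      + (\<Sum>k | mdeg k \<le> mdeg j. (\<Sum>\<kappa>\<in>I_set j k. h \<kappa> (k - \<kappa>)) * M k)"
    unfolding sum.distrib sum_d_co_eq_first_order_terms[OF L] sum_over_I_set[OF L(1)] ..
  also have "(\<Sum>k | mdeg k \<le> mdeg j. (\<Sum>\<kappa>\<in>I_set j k. h \<kappa> (k - \<kappa>)) * M k)
      = (\<Sum>k | mdeg k < mdeg j. (\<Sum>\<kappa>\<in>I_set j k. h \<kappa> (k - \<kappa>)) * M k)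
       + (\<Sum>k | mdeg k = mdeg j. (\<Sum>\<kappa>\<in>I_set j k. h \<kappa> (k - \<kappa>)) * M k)"
    by (subst sum.union_disjoint[symmetric])
       (auto intro!: sum.cong finite_subset[OF _ finite_mdeg_le[of "mdeg j"]])
  also have "(\<Sum>k | mdeg k = mdeg j. (\<Sum>\<kappa>\<in>I_set j k. h \<kappa> (k - \<kappa>)) * M k) = - M j"
  proof -
    have "(\<Sum>k | mdeg k = mdeg j. (\<Sum>\<kappa>\<in>I_set j k. h \<kappa> (k - \<kappa>)) * M k)
        = (\<Sum>k | mdeg k = mdeg j. if k = j then - M k else 0)"
    proof (rule sum.cong)
      fix k assume "k \<in> {k. mdeg k = mdeg j}"
      then have "(\<Sum>\<kappa>\<in>I_set j k. h \<kappa> (k - \<kappa>)) = (if k = j then - 1 else 0)"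
        unfolding h_def by (intro top_coefficient x j) simp
      then show "(\<Sum>\<kappa>\<in>I_set j k. h \<kappa> (k - \<kappa>)) * M k = (if k = j then - M k else 0)" by simp
    qed simp
    also have "\<dots> = - M j"
      by (subst sum.delta) (auto intro: finite_subset[OF _ finite_mdeg_le[of "mdeg j"]])
    finally show ?thesis .
  qed
  finally have "M j = (\<Sum>k | mdeg k < mdeg j. (\<Sum>\<kappa>\<in>I_set j k. h \<kappa> (k - \<kappa>)) * M k)
      + (\<Sum>k | mdeg k < mdeg j. d_co x j k * M k)"
    by simp
  then show ?thesis
    by (simp add: c_co_def h_def M_def distrib_right sum.distrib)
qed

lemma mom_eq_r_co:
  assumes x: "x \<in> decaying" "r_defined x"
  shows "mom x j = (\<Sum>i\<in>UNIV. r_co x j (mi i) * mom x (mi i))"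
proof (induction "mdeg j" arbitrary: j rule: less_induct)
  case less
  show ?case
  proof (cases "mdeg j \<le> 4")
    case True
    have "(\<Sum>i\<in>UNIV. r_co x j (mi i) * mom x (mi i)) = (\<Sum>i\<in>UNIV. if i = Idx j then mom x j else 0)"
      using True mi_Idx by (intro sum.cong) (auto simp: r_co.simps mi_inverse)
    then show ?thesis by simp
  next
    case False
    then have "mom x j = (\<Sum>k | mdeg k < mdeg j. c_co x j k * mom x k)"
      by (intro mom_reduction x) simp
    also have "\<dots> = (\<Sum>k | mdeg k < mdeg j. c_co x j k * (\<Sum>i\<in>UNIV. r_co x k (mi i) * mom x (mi i)))"
      using less by (intro sum.cong) auto
    also have "\<dots> = (\<Sum>i\<in>UNIV. (\<Sum>k | mdeg k < mdeg j. c_co x j k * r_co x k (mi i)) * mom x (mi i))"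
      unfolding sum_distrib_left sum_distrib_right by (subst sum.swap) (simp add: mult.assoc)
    also have "\<dots> = (\<Sum>i\<in>UNIV. r_co x j (mi i) * mom x (mi i))"
      using False by (subst (2) r_co.simps) simp
    finally show ?thesis .
  qed
qed

lemma Gam_mat_eq_hess:
  assumes x: "x \<in> decaying" "r_defined x" and eq: "momvec x = s *\<^sub>R g + (1 - s) *\<^sub>R g0"
  shows "Gam_mat g g0 x s = hess x"
proof -
  have m: "s * g $ i + (1 - s) * g0 $ i = mom x (mi i)" for i
    using arg_cong[OF eq, of "\<lambda>v. v $ i"] by (simp add: momvec_def)
  have "Gam g g0 x s j = mom x j" for j
    by (cases "mdeg j \<le> 4") (simp_all add: Gam_def m mi_Idx mom_eq_r_co[OF x, of j])
  then show ?thesis by (simp add: Gam_mat_def hess_def)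
qed

section \<open>The domain of the curve\<close>

definition admissible :: "(real ^ idx4) set" where
  "admissible = {x \<in> decaying. r_defined x}"

lemma forall_6: "(\<forall>i :: 6. P i) \<longleftrightarrow> P 1 \<and> P 2 \<and> P 3 \<and> P 4 \<and> P 5 \<and> P 6"
  by (metis exhaust_6)

lemma continuous_A_mat: "continuous_on S (\<lambda>x. A_mat x $ i $ k)"
proof -
  have "\<forall>i k. continuous_on S (\<lambda>x. A_mat x $ i $ k)"
    unfolding A_mat_def forall_6 vector_6 by (intro conjI continuous_intros)
  then show ?thesis by blast
qed

lemma open_admissible: "open admissible"
proof -
  have "continuous_on UNIV (\<lambda>x. det (A_mat x))"
    unfolding det_def by (intro continuous_intros continuous_A_mat)
  then have "open {x. det (A_mat x) \<noteq> 0}"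
    by (intro open_Collect_neq continuous_intros)
  moreover have "open {x :: real ^ idx4. co x 4 0 \<noteq> 0}"
    by (intro open_Collect_neq continuous_intros)
  moreover have "admissible = decaying \<inter> ({x. co x 4 0 \<noteq> 0} \<inter> {x. det (A_mat x) \<noteq> 0})"
    by (auto simp: admissible_def r_defined_def)
  ultimately show ?thesis using open_decaying by (metis open_Int)
qed

text \<open>The value of the leading form at \<open>(1, 0)\<close> is the coefficient with index \<open>(4, 0)\<close>, which is therefore
  negative.\<close>

lemma lambda_star_admissible:
  assumes "g \<in> G0_set"
  shows "lambda_star g \<in> admissible" and "momvec (lambda_star g) = g"
proof -
  let ?x = "lambda_star g"
  have g: "g \<in> G_set" "det (A_mat ?x) \<noteq> 0" using assms by (auto simp: G0_set_def)
  have "(\<Sum>i | mdeg (mi i) = 4. ?x $ i * monom2 (mi i) (1, 0)) < 0"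
    using g(1) by (auto simp: G_set_def zero_prod_def)
  also have "(\<Sum>i | mdeg (mi i) = 4. ?x $ i * monom2 (mi i) (1, 0))
      = (\<Sum>i | mdeg (mi i) = 4. if i = Idx (4, 0) then ?x $ i else 0)"
  proof (rule sum.cong)
    fix i assume "i \<in> {i. mdeg (mi i) = 4}"
    then have "snd (mi i) = 0 \<longleftrightarrow> mi i = (4, 0)" by (auto simp: mdeg_def prod_eq_iff)
    moreover have "mi i = (4, 0) \<longleftrightarrow> i = Idx (4, 0)"
      using mi_Idx[of "(4, 0)"] by (metis mi_inverse mdeg_def fst_conv snd_conv add.right_neutral order_refl)
    ultimately show "?x $ i * monom2 (mi i) (1, 0) = (if i = Idx (4, 0) then ?x $ i else 0)"
      by (auto simp: monom2_def)
  qed simp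
  also have "\<dots> = co ?x 4 0"
    by (simp add: mi_Idx mdeg_def)
  finally show "?x \<in> admissible"
    using momvec_lambda_star[OF g(1)] g(2) by (simp add: admissible_def r_defined_def)
  show "momvec ?x = g" by (rule momvec_lambda_star[OF g(1)])
qed

section \<open>Smoothness\<close>

text \<open>If \<open>x\<close> satisfies \<open>hess (x s) *v x' s = w\<close>, this algebra of functions is closed under
  differentiation; the generator \<open>1 / det\<close> is what Cramer's rule needs to express \<open>x'\<close>.\<close>

inductive curve_alg :: "(real \<Rightarrow> real ^ idx4) \<Rightarrow> (real \<Rightarrow> real) \<Rightarrow> bool" for x where
  const: "curve_alg x (\<lambda>s. c)"
| coord: "curve_alg x (\<lambda>s. x s $ k)"
| mom: "curve_alg x (\<lambda>s. mom (x s) j)"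
| inv_det: "curve_alg x (\<lambda>s. 1 / det (hess (x s)))"
| add: "curve_alg x u \<Longrightarrow> curve_alg x v \<Longrightarrow> curve_alg x (\<lambda>s. u s + v s)"
| mult: "curve_alg x u \<Longrightarrow> curve_alg x v \<Longrightarrow> curve_alg x (\<lambda>s. u s * v s)"

lemma curve_alg_sum: "(\<And>i. i \<in> A \<Longrightarrow> curve_alg x (u i)) \<Longrightarrow> curve_alg x (\<lambda>s. \<Sum>i\<in>A. u i s)"
  by (induction A rule: infinite_finite_induct) (auto intro: curve_alg.intros)

lemma curve_alg_prod: "(\<And>i. i \<in> A \<Longrightarrow> curve_alg x (u i)) \<Longrightarrow> curve_alg x (\<lambda>s. \<Prod>i\<in>A. u i s)"
  by (induction A rule: infinite_finite_induct) (auto intro: curve_alg.intros)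

lemma curve_alg_det:
  fixes B :: "real \<Rightarrow> real ^ 'n ^ 'n"
  assumes "\<And>i j. curve_alg x (\<lambda>s. B s $ i $ j)"
  shows "curve_alg x (\<lambda>s. det (B s))"
  unfolding det_def by (intro curve_alg_sum curve_alg.mult curve_alg.const curve_alg_prod assms)

definition diff_in_alg :: "real set \<Rightarrow> (real \<Rightarrow> real ^ idx4) \<Rightarrow> (real \<Rightarrow> real) \<Rightarrow> bool" where
  "diff_in_alg S x u \<longleftrightarrow> (\<exists>u'. curve_alg x u' \<and> (\<forall>s\<in>S. (u has_real_derivative u' s) (at s)))"

lemma diff_in_algI:
  "curve_alg x u' \<Longrightarrow> (\<And>s. s \<in> S \<Longrightarrow> (u has_real_derivative u' s) (at s)) \<Longrightarrow> diff_in_alg S x u"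
  by (auto simp: diff_in_alg_def)

lemma diff_in_alg_add:
  assumes "diff_in_alg S x u" "diff_in_alg S x v"
  shows "diff_in_alg S x (\<lambda>s. u s + v s)"
  using assms unfolding diff_in_alg_def by (blast intro: curve_alg.add DERIV_add)

lemma diff_in_alg_mult:
  assumes "curve_alg x u" "curve_alg x v" "diff_in_alg S x u" "diff_in_alg S x v"
  shows "diff_in_alg S x (\<lambda>s. u s * v s)"
proof -
  obtain u' v' where *: "curve_alg x u'" "\<And>s. s \<in> S \<Longrightarrow> (u has_real_derivative u' s) (at s)"
      "curve_alg x v'" "\<And>s. s \<in> S \<Longrightarrow> (v has_real_derivative v' s) (at s)"
    using assms(3,4) unfolding diff_in_alg_def by blast
  show ?thesis
    by (rule diff_in_algI[of x "\<lambda>s. u' s * v s + v' s * u s"])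
       (intro curve_alg.intros * assms, intro DERIV_mult *)
qed

lemma diff_in_alg_sum:
  "(\<And>i. i \<in> A \<Longrightarrow> diff_in_alg S x (u i)) \<Longrightarrow> diff_in_alg S x (\<lambda>s. \<Sum>i\<in>A. u i s)"
proof (induction A rule: infinite_finite_induct)
  case (insert a A)
  then show ?case by (simp add: diff_in_alg_add)
qed (auto intro!: diff_in_algI[of x "\<lambda>s. 0"] curve_alg.const)

lemma diff_in_alg_prod:
  "(\<And>i. i \<in> A \<Longrightarrow> curve_alg x (u i)) \<Longrightarrow> (\<And>i. i \<in> A \<Longrightarrow> diff_in_alg S x (u i)) \<Longrightarrow>
    diff_in_alg S x (\<lambda>s. \<Prod>i\<in>A. u i s)"
proof (induction A rule: infinite_finite_induct)
  case (insert a A)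
  then show ?case by (simp add: diff_in_alg_mult curve_alg_prod)
qed (auto intro!: diff_in_algI[of x "\<lambda>s. 0"] curve_alg.const)

lemma diff_in_alg_det:
  fixes B :: "real \<Rightarrow> real ^ 'n ^ 'n"
  assumes "\<And>i j. curve_alg x (\<lambda>s. B s $ i $ j)" "\<And>i j. diff_in_alg S x (\<lambda>s. B s $ i $ j)"
  shows "diff_in_alg S x (\<lambda>s. det (B s))"
  unfolding det_def
  by (intro diff_in_alg_sum diff_in_alg_mult curve_alg.const curve_alg_prod diff_in_alg_prod assms
      diff_in_algI[OF curve_alg.const[of _ 0]]) simp

text \<open>By Cramer's rule \<open>x'\<close> has coordinates in the algebra (\<open>xd\<close> below), and then so have the derivatives of
  the other generators: that of \<open>mom (x s) j\<close> is \<open>\<Sum>\<^sub>k x'\<^sub>k mom (x s) (j + k)\<close>, and that of \<open>1 / det\<close> involves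
  the derivative of a polynomial in the moments.\<close>

lemma curve_alg_differentiable:
  assumes x: "\<And>s. s \<in> S \<Longrightarrow> x s \<in> decaying"
    and der: "\<And>s. s \<in> S \<Longrightarrow> (x has_vector_derivative x' s) (at s)"
    and ode: "\<And>s. s \<in> S \<Longrightarrow> hess (x s) *v x' s = w"
    and u: "curve_alg x u"
  shows "diff_in_alg S x u"
proof -
  have det: "det (hess (x s)) \<noteq> 0" if "s \<in> S" for s
    using invertible_hess[OF x[OF that]] by (simp add: invertible_det_nz)
  have alg_hess: "curve_alg x (\<lambda>s. hess (x s) $ i $ j)" for i j
    by (simp add: hess_def curve_alg.mom)
  define xd where "xd s = (\<chi> k. det (\<chi> i j. if j = k then w $ i else hess (x s) $ i $ j) * (1 / det (hess (x s))))" for s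
  have xd: "x' s = xd s" if "s \<in> S" for s
    using ode[OF that] unfolding cramer[OF det[OF that]] by (simp add: xd_def vec_eq_iff)
  have alg_xd: "curve_alg x (\<lambda>s. xd s $ k)" for k
  proof -
    have entry: "curve_alg x (\<lambda>s. if j = k then w $ i else hess (x s) $ i $ j)" for i j
      by (cases "j = k") (simp_all add: alg_hess curve_alg.const)
    show ?thesis
      unfolding xd_def vec_lambda_beta
      by (intro curve_alg.mult curve_alg_det curve_alg.inv_det) (simp only: vec_lambda_beta entry)
  qed
  have mom: "diff_in_alg S x (\<lambda>s. mom (x s) j)" for j
  proof (rule diff_in_algI[of x "\<lambda>s. \<Sum>k\<in>UNIV. xd s $ k * mom (x s) (j + mi k)"])
    show "curve_alg x (\<lambda>s. \<Sum>k\<in>UNIV. xd s $ k * mom (x s) (j + mi k))"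
      by (intro curve_alg_sum curve_alg.mult alg_xd curve_alg.mom)
    fix s assume s: "s \<in> S"
    have "((\<lambda>s. mom (x s) j) has_derivative
        (\<lambda>h. \<Sum>k\<in>UNIV. (h *\<^sub>R xd s) $ k * mom (x s) (j + mi k))) (at s)"
      using has_derivative_compose[OF der[OF s, unfolded has_vector_derivative_def xd[OF s]]
          has_derivative_mom[OF x[OF s]]] by simp
    then show "((\<lambda>s. mom (x s) j) has_real_derivative (\<Sum>k\<in>UNIV. xd s $ k * mom (x s) (j + mi k))) (at s)"
      by (rule has_derivative_imp_has_field_derivative) (simp add: sum_distrib_left mult.assoc)
  qed
  show ?thesis
    using u
  proof induction
    case (const c)
    show ?case by (rule diff_in_algI[OF curve_alg.const[of _ 0]]) simp
  next
    case (coord k)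
    have "((\<lambda>s. x s $ k) has_vector_derivative xd s $ k) (at s)" if "s \<in> S" for s
      using bounded_linear.has_vector_derivative[OF bounded_linear_vec_nth der[OF that]] xd[OF that] by simp
    then show ?case
      by (intro diff_in_algI[OF alg_xd[of k]]) (simp add: has_real_derivative_iff_has_vector_derivative)
  next
    case (mom j)
    show ?case by (rule \<open>diff_in_alg S x (\<lambda>s. mom (x s) j)\<close>)
  next
    case inv_det
    have "diff_in_alg S x (\<lambda>s. det (hess (x s)))"
      by (intro diff_in_alg_det alg_hess) (simp add: hess_def mom)
    then obtain d where d: "curve_alg x d"
        "\<And>s. s \<in> S \<Longrightarrow> ((\<lambda>s. det (hess (x s))) has_real_derivative d s) (at s)"
      unfolding diff_in_alg_def by blast
    show ?case
    proof (rule diff_in_algI)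
      show "curve_alg x (\<lambda>s. - 1 * (d s * (1 / det (hess (x s)) * (1 / det (hess (x s))))))"
        by (intro curve_alg.intros d(1))
      show "((\<lambda>s. 1 / det (hess (x s))) has_real_derivative
          - 1 * (d s * (1 / det (hess (x s)) * (1 / det (hess (x s)))))) (at s)" if "s \<in> S" for s
        using d(2)[OF that] det[OF that]
        by (auto intro!: derivative_eq_intros simp: divide_simps)
    qed
  next
    case (add u v)
    then show ?case by (intro diff_in_alg_add)
  next
    case (mult u v)
    then show ?case by (intro diff_in_alg_mult)
  qed
qed

text \<open>The coordinates of \<open>x\<close> belong to the algebra, in which one can differentiate repeatedly.\<close>

lemma smooth_curve_of_ode:
  assumes x: "\<And>s. s \<in> S \<Longrightarrow> x s \<in> decaying"
    and der: "\<And>s. s \<in> S \<Longrightarrow> (x has_vector_derivative x' s) (at s)"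
    and ode: "\<And>s. s \<in> S \<Longrightarrow> hess (x s) *v x' s = w"
  shows "smooth_curve_on S x"
proof -
  define V where "V = {v :: real \<Rightarrow> real ^ idx4. \<forall>k. curve_alg x (\<lambda>s. v s $ k)}"
  have step: "\<exists>v'\<in>V. \<forall>s\<in>S. (v has_vector_derivative v' s) (at s)" if "v \<in> V" for v
  proof -
    have "\<exists>d. curve_alg x d \<and> (\<forall>s\<in>S. ((\<lambda>s. v s $ k) has_real_derivative d s) (at s))" for k
      using curve_alg_differentiable[OF x der ode, of S "\<lambda>s. v s $ k"] that
      by (simp add: V_def diff_in_alg_def)
    then obtain d where d: "\<And>k. curve_alg x (d k)"
        "\<And>k s. s \<in> S \<Longrightarrow> ((\<lambda>s. v s $ k) has_real_derivative d k s) (at s)"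
      by metis
    have "(v has_vector_derivative (\<chi> k. d k s)) (at s)" if s: "s \<in> S" for s
      unfolding has_vector_derivative_def has_derivative_componentwise_within[of v]
    proof
      fix b :: "real ^ idx4" assume "b \<in> Basis"
      then obtain k where b: "b = axis k 1" by (auto simp: Basis_vec_def)
      show "((\<lambda>s. v s \<bullet> b) has_derivative (\<lambda>h. (h *\<^sub>R (\<chi> k. d k s)) \<bullet> b)) (at s)"
        using d(2)[OF s, of k] by (simp add: b inner_axis has_field_derivative_def mult_commute_abs)
    qed
    then show ?thesis
      using d(1) by (intro bexI[of _ "\<lambda>s. \<chi> k. d k s"]) (auto simp: V_def)
  qed
  have "\<exists>D. \<forall>n. (D n \<in> V \<and> (n = 0 \<longrightarrow> D n = x)) \<and> (\<forall>s\<in>S. (D n has_vector_derivative D (Suc n) s) (at s))"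
  proof (rule dependent_nat_choice)
    show "\<exists>v. v \<in> V \<and> (0 = (0::nat) \<longrightarrow> v = x)"
      by (auto simp: V_def curve_alg.coord)
  qed (use step in blast)
  then show ?thesis unfolding smooth_curve_on_def by blast
qed

section \<open>The solution curve\<close>

theorem corollary9:
  fixes g g0 :: "real ^ idx4"
  assumes "\<And>s :: real. s \<in> {0..1} \<Longrightarrow> s *\<^sub>R g + (1 - s) *\<^sub>R g0 \<in> G0_set"
  shows "\<exists>(x :: real \<Rightarrow> real ^ idx4) S.
           open S \<and> {0..1} \<subseteq> S \<and> is_interval S \<and>
           smooth_curve_on S x \<and>
           (\<forall>s\<in>S. r_defined (x s) \<and>
                  Gam_mat g g0 (x s) s *v vector_derivative x (at s) = g - g0) \<and>
           x 0 = lambda_star g0 \<and>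
           (\<forall>s\<in>{0..1}. r_defined (x s) \<and> invertible (Gam_mat g g0 (x s) s)) \<and>
           x 1 = lambda_star g"
proof -
  define m where "m s = s *\<^sub>R g + (1 - s) *\<^sub>R g0" for s :: real
  \<comment> \<open>The curve is the preimage of the segment under the moment map, which is injective with open image.\<close>
  define Y where "Y = the_inv_into admissible momvec"
  define x where "x s = Y (m s)" for s
  have inj: "inj_on momvec admissible"
    by (rule inj_on_subset[OF inj_on_momvec]) (auto simp: admissible_def)
  have cont: "continuous_on admissible momvec"
    by (rule continuous_on_subset[OF continuous_momvec]) (auto simp: admissible_def)
  have Y: "Y (momvec z) = z" if "z \<in> admissible" for z
    unfolding Y_def by (rule the_inv_into_f_f[OF inj that])
  define U where "U = m -` (momvec ` admissible)"
  have "open (momvec ` admissible)"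
    by (rule invariance_of_domain[OF cont open_admissible inj])
  moreover have "continuous_on UNIV m" unfolding m_def by (intro continuous_intros)
  ultimately have "open U" unfolding U_def by (intro open_vimage)
  have unit: "{0..1} \<subseteq> U"
  proof
    fix s :: real assume "s \<in> {0..1}"
    from assms[OF this] have "m s \<in> G0_set" by (simp add: m_def)
    from lambda_star_admissible[OF this] have "m s \<in> momvec ` admissible" by (metis imageI)
    then show "s \<in> U" by (simp add: U_def)
  qed
  \<comment> \<open>\<open>U\<close> need not be connected; its component of 0 is an interval that contains \<open>[0, 1]\<close>.\<close>
  define S where "S = connected_component_set U 0"
  have "open S" unfolding S_def by (rule open_connected_component[OF \<open>open U\<close>])
  have "is_interval S" unfolding S_def is_interval_connected_1 by (rule connected_connected_component)
  have "{0..1} \<subseteq> S"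
    unfolding S_def by (rule connected_component_maximal[OF _ _ unit]) auto
  have "S \<subseteq> U" unfolding S_def by (rule connected_component_subset)
  have adm: "x s \<in> admissible" and mx: "momvec (x s) = m s" if s: "s \<in> S" for s
  proof -
    obtain z where "z \<in> admissible" "m s = momvec z"
      using s \<open>S \<subseteq> U\<close> by (auto simp: U_def)
    then show "x s \<in> admissible" "momvec (x s) = m s" by (simp_all add: x_def Y)
  qed
  then have dec: "x s \<in> decaying" and rd: "r_defined (x s)" if "s \<in> S" for s
    using that by (auto simp: admissible_def)
  define x' where "x' s = matrix_inv (hess (x s)) *v (g - g0)" for s
  have inv: "hess (x s) ** matrix_inv (hess (x s)) = mat 1" if "s \<in> S" for s
    by (intro matrix_mult_matrix_inv invertible_hess dec that)
  have ode: "hess (x s) *v x' s = g - g0" if "s \<in> S" for s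
    by (simp add: x'_def matrix_vector_mul_assoc inv[OF that])
  have der: "(x has_vector_derivative x' s) (at s)" if s: "s \<in> S" for s
  proof -
    have derY: "(Y has_derivative (\<lambda>h. matrix_inv (hess (x s)) *v h)) (at (momvec (x s)))"
    proof (rule has_derivative_inverse_strong[OF open_admissible adm[OF s] cont Y])
      show "(momvec has_derivative (\<lambda>h. hess (x s) *v h)) (at (x s))"
        by (rule has_derivative_momvec[OF dec[OF s]])
      show "(\<lambda>h. hess (x s) *v h) \<circ> (\<lambda>h. matrix_inv (hess (x s)) *v h) = id"
        by (auto simp: matrix_vector_mul_assoc inv[OF s])
    qed
    have derm: "(m has_derivative (\<lambda>h. h *\<^sub>R (g - g0))) (at s)"
      unfolding m_def by (auto intro!: derivative_eq_intros simp: algebra_simps)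
    have "((\<lambda>s. Y (m s)) has_derivative (\<lambda>h. matrix_inv (hess (x s)) *v (h *\<^sub>R (g - g0)))) (at s)"
      by (rule has_derivative_compose[OF derm derY[unfolded mx[OF s]]])
    then show ?thesis
      by (simp add: has_vector_derivative_def x_def[abs_def] x'_def matrix_vector_mult_scaleR)
  qed
  have Gam: "Gam_mat g g0 (x s) s = hess (x s)" if "s \<in> S" for s
    using mx[OF that] by (intro Gam_mat_eq_hess dec rd that) (simp add: m_def)
  have ends: "x s = lambda_star (m s)" if "s \<in> {0..1}" for s
    using lambda_star_admissible[OF assms[OF that]] Y unfolding x_def m_def by metis
  have "smooth_curve_on S x"
    by (rule smooth_curve_of_ode[OF dec der ode])
  moreover have "\<forall>s\<in>S. r_defined (x s) \<and> Gam_mat g g0 (x s) s *v vector_derivative x (at s) = g - g0"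
    using rd Gam ode vector_derivative_at[OF der] by simp
  moreover have "\<forall>s\<in>{0..1}. r_defined (x s) \<and> invertible (Gam_mat g g0 (x s) s)"
    using rd Gam invertible_hess[OF dec] \<open>{0..1} \<subseteq> S\<close> by (metis subsetD)
  moreover have "x 0 = lambda_star g0" "x 1 = lambda_star g"
    using ends[of 0] ends[of 1] by (simp_all add: m_def)
  ultimately show ?thesis
    using \<open>open S\<close> \<open>{0..1} \<subseteq> S\<close> \<open>is_interval S\<close> by blast
qed

end
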